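(* Given any fair division instance $\mathcal{I}=\langle [n],[m],\{v_i\}_{i=1}^n \rangle$ with range parameter $\gamma$, one can compute a $2\gamma$-tEFx allocation in polynomial time.
   Context: A fair division instance $\langle [n],[m],\{v_i\}_{i=1}^n\rangle$ consists of agents $[n]=\{1,\dots,n\}$, indivisible goods $[m]=\{1,\dots,m\}$, and additive valuations $v_i:2^{[m]}\to\mathbb{R}_{\ge 0}$, i.e. $v_i(S)=\sum_{g\in S}v_i(g)$. Let $P_i=\{g\in[m]:v_i(g)>0\}$. Throughout, $P_i\neq\emptyset$ for every agent $i$, and every good has positive value for at least one agent. For a good $g$, $\gamma_g=\frac{\min_{j:v_j(g)>0}v_j(g)}{\max_i v_i(g)}$; the range parameter of the instance is $\gamma=\min_{g\in[m]}\gamma_g\in(0,1]$. Write $S+g=S\cup\{g\}$, $S-g=S\setminus\{g\}$. An allocation $\mathcal{A}=(A_1,\dots,A_n)$ is a tuple of pairwise disjoint subsets of $[m]$ with $\bigcup_i A_i=[m]$. For $\alpha\in(0,1)$, $\mathcal{A}$ is $\alpha$-tEFx (approximately envy-free up to the transfer of any positively-valued good) if for every pair of agents $i,j\in[n]$ and every good $g\in A_j\cap P_i$ we have $v_i(A_i+g)\ge\alpha\,v_i(A_j-g)$. Setting $\alpha=1$ gives exact tEFx. Convention: for $\beta>1$, a $\beta$-tEFx allocation means an exact tEFx allocation. *)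

theory Defs
  imports Complex_Main "HOL-Computational_Algebra.Polynomial"
begin

section \<open>Fair division instances\<close>

text \<open>An additive valuation is given by its values on single goods: \<open>v i g\<close> is the value of
  good \<open>g\<close> for agent \<open>i\<close>. Only agents in \<open>{1..n}\<close> and goods in \<open>{1..m}\<close> are relevant.\<close>

definition val :: "(nat \<Rightarrow> nat \<Rightarrow> real) \<Rightarrow> nat \<Rightarrow> nat set \<Rightarrow> real" where
  "val v i S = (\<Sum>g\<in>S. v i g)"

definition pos_goods :: "nat \<Rightarrow> (nat \<Rightarrow> nat \<Rightarrow> real) \<Rightarrow> nat \<Rightarrow> nat set" where
  "pos_goods m v i = {g \<in> {1..m}. v i g > 0}"

definition fair_division_instance :: "nat \<Rightarrow> nat \<Rightarrow> (nat \<Rightarrow> nat \<Rightarrow> real) \<Rightarrow> bool" where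
  "fair_division_instance n m v \<longleftrightarrow>
     n \<ge> 1 \<and>
     (\<forall>i\<in>{1..n}. \<forall>g\<in>{1..m}. v i g \<ge> 0) \<and>
     (\<forall>i\<in>{1..n}. pos_goods m v i \<noteq> {}) \<and>
     (\<forall>g\<in>{1..m}. \<exists>i\<in>{1..n}. v i g > 0)"

definition good_range :: "nat \<Rightarrow> (nat \<Rightarrow> nat \<Rightarrow> real) \<Rightarrow> nat \<Rightarrow> real" where
  "good_range n v g =
     Min ((\<lambda>j. v j g) ` {j \<in> {1..n}. v j g > 0}) / Max ((\<lambda>i. v i g) ` {1..n})"

definition range_param :: "nat \<Rightarrow> nat \<Rightarrow> (nat \<Rightarrow> nat \<Rightarrow> real) \<Rightarrow> real" where
  "range_param n m v = Min (good_range n v ` {1..m})"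

definition is_allocation :: "nat \<Rightarrow> nat \<Rightarrow> (nat \<Rightarrow> nat set) \<Rightarrow> bool" where
  "is_allocation n m A \<longleftrightarrow>
     (\<forall>i\<in>{1..n}. \<forall>j\<in>{1..n}. i \<noteq> j \<longrightarrow> A i \<inter> A j = {}) \<and> (\<Union>i\<in>{1..n}. A i) = {1..m}"

definition tEFx_ineq ::
    "real \<Rightarrow> nat \<Rightarrow> nat \<Rightarrow> (nat \<Rightarrow> nat \<Rightarrow> real) \<Rightarrow> (nat \<Rightarrow> nat set) \<Rightarrow> bool" where
  "tEFx_ineq \<alpha> n m v A \<longleftrightarrow>
     (\<forall>i\<in>{1..n}. \<forall>j\<in>{1..n}. \<forall>g \<in> A j \<inter> pos_goods m v i.
        val v i (A i \<union> {g}) \<ge> \<alpha> * val v i (A j - {g}))"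

text \<open>By convention a factor above 1 stands for the exact notion.\<close>

definition is_tEFx ::
    "real \<Rightarrow> nat \<Rightarrow> nat \<Rightarrow> (nat \<Rightarrow> nat \<Rightarrow> real) \<Rightarrow> (nat \<Rightarrow> nat set) \<Rightarrow> bool" where
  "is_tEFx \<beta> n m v A \<longleftrightarrow>
     is_allocation n m A \<and> (if \<beta> > 1 then tEFx_ineq 1 n m v A else tEFx_ineq \<beta> n m v A)"


section \<open>Model of computation\<close>

text \<open>
  Valuations are real, so time is measured on a real RAM, presented as a while language with
  arrays. Besides the read-only valuation matrix, the memory consists of arrays of naturals and
  arrays of reals, which are named by the program text and addressed by computed naturals; a scalar
  is an array used at index 0 only. Control flow can depend on reals only through comparisons.

  Arithmetic is limited to addition, subtraction and comparison. Without
  multiplication, a unit-cost step at most doubles the largest absolute value in memory; on rational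
  inputs, written over a common denominator, it lengthens the numbers by a constant number of bits.
  Hence a number of steps polynomial in \<open>n\<close> and \<open>m\<close> is also polynomial time in the bit model, and
  no unit-cost repeated squaring is possible.
\<close>

datatype nexp =
    NConst nat
  | NGet string nexp
  | NAdd nexp nexp
  | NSub nexp nexp

datatype rexp =
    RConst rat
  | RGet string nexp
  | RVal nexp nexp
  | RAdd rexp rexp
  | RSub rexp rexp

datatype bexp =
    NLess nexp nexp
  | RLess rexp rexp
  | BNot bexp
  | BAnd bexp bexp

datatype com =
    Skip
  | NAssign string nexp nexp  \<comment> \<open>\<open>NAssign a i e\<close> is \<open>a[i] := e\<close>\<close>
  | RAssign string nexp rexp
  | Seq com com
  | Cond bexp com com
  | While bexp com

record state =
  matrix :: "nat \<Rightarrow> nat \<Rightarrow> real"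
  nmem :: "string \<Rightarrow> nat \<Rightarrow> nat"
  rmem :: "string \<Rightarrow> nat \<Rightarrow> real"

fun neval :: "nexp \<Rightarrow> state \<Rightarrow> nat" where
  "neval (NConst k) s = k"
| "neval (NGet a i) s = nmem s a (neval i s)"
| "neval (NAdd e f) s = neval e s + neval f s"
| "neval (NSub e f) s = neval e s - neval f s"

fun reval :: "rexp \<Rightarrow> state \<Rightarrow> real" where
  "reval (RConst q) s = of_rat q"
| "reval (RGet a i) s = rmem s a (neval i s)"
| "reval (RVal i g) s = matrix s (neval i s) (neval g s)"
| "reval (RAdd e f) s = reval e s + reval f s"
| "reval (RSub e f) s = reval e s - reval f s"

fun beval :: "bexp \<Rightarrow> state \<Rightarrow> bool" where
  "beval (NLess e f) s \<longleftrightarrow> neval e s < neval f s"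
| "beval (RLess e f) s \<longleftrightarrow> reval e s < reval f s"
| "beval (BNot b) s \<longleftrightarrow> \<not> beval b s"
| "beval (BAnd b c) s \<longleftrightarrow> beval b s \<and> beval c s"

text \<open>Evaluating an expression costs one step for every constant, memory access and operation.\<close>

fun ncost :: "nexp \<Rightarrow> nat" where
  "ncost (NConst k) = 1"
| "ncost (NGet a i) = 1 + ncost i"
| "ncost (NAdd e f) = 1 + ncost e + ncost f"
| "ncost (NSub e f) = 1 + ncost e + ncost f"

fun rcost :: "rexp \<Rightarrow> nat" where
  "rcost (RConst q) = 1"
| "rcost (RGet a i) = 1 + ncost i"
| "rcost (RVal i g) = 1 + ncost i + ncost g"
| "rcost (RAdd e f) = 1 + rcost e + rcost f"
| "rcost (RSub e f) = 1 + rcost e + rcost f"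

fun bcost :: "bexp \<Rightarrow> nat" where
  "bcost (NLess e f) = 1 + ncost e + ncost f"
| "bcost (RLess e f) = 1 + rcost e + rcost f"
| "bcost (BNot b) = 1 + bcost b"
| "bcost (BAnd b c) = 1 + bcost b + bcost c"

definition nupdate :: "string \<Rightarrow> nat \<Rightarrow> nat \<Rightarrow> state \<Rightarrow> state" where
  "nupdate a k x s = s\<lparr>nmem := (nmem s)(a := (nmem s a)(k := x))\<rparr>"

definition rupdate :: "string \<Rightarrow> nat \<Rightarrow> real \<Rightarrow> state \<Rightarrow> state" where
  "rupdate a k x s = s\<lparr>rmem := (rmem s)(a := (rmem s a)(k := x))\<rparr>"

text \<open>\<open>exec c s t s'\<close>: started in \<open>s\<close>, the command \<open>c\<close> terminates in \<open>s'\<close> after exactly \<open>t\<close> steps.\<close>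

inductive exec :: "com \<Rightarrow> state \<Rightarrow> nat \<Rightarrow> state \<Rightarrow> bool" where
  Skip: "exec Skip s 1 s"
| NAssign: "exec (NAssign a i e) s (1 + ncost i + ncost e) (nupdate a (neval i s) (neval e s) s)"
| RAssign: "exec (RAssign a i e) s (1 + ncost i + rcost e) (rupdate a (neval i s) (reval e s) s)"
| Seq: "exec c s t s' \<Longrightarrow> exec d s' u s'' \<Longrightarrow> exec (Seq c d) s (t + u) s''"
| CondTrue: "beval b s \<Longrightarrow> exec c s t s' \<Longrightarrow> exec (Cond b c d) s (1 + bcost b + t) s'"
| CondFalse: "\<not> beval b s \<Longrightarrow> exec d s t s' \<Longrightarrow> exec (Cond b c d) s (1 + bcost b + t) s'"
| WhileFalse: "\<not> beval b s \<Longrightarrow> exec (While b c) s (1 + bcost b) s"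
| WhileTrue: "beval b s \<Longrightarrow> exec c s t s' \<Longrightarrow> exec (While b c) s' u s'' \<Longrightarrow>
    exec (While b c) s (1 + bcost b + t + u) s''"

inductive_cases exec_SkipE: "exec Skip s t s'"
  and exec_NAssignE: "exec (NAssign a i e) s t s'"
  and exec_RAssignE: "exec (RAssign a i e) s t s'"
  and exec_SeqE: "exec (Seq c d) s t s'"
  and exec_CondE: "exec (Cond b c d) s t s'"
  and exec_WhileE: "exec (While b c) s t s'"

lemma exec_deterministic:
  "exec c s t s' \<Longrightarrow> exec c s u s'' \<Longrightarrow> t = u \<and> s' = s''"
proof (induction arbitrary: u s'' rule: exec.induct)
  case (Seq c s t s' d w r)
  from Seq.prems show ?case
    by (rule exec_SeqE) (auto dest: Seq.IH)
next
  case (CondTrue b s c t s' d)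
  from CondTrue.prems show ?case
    by (rule exec_CondE) (use CondTrue.hyps(1) in \<open>auto dest: CondTrue.IH\<close>)
next
  case (CondFalse b s d t s' c)
  from CondFalse.prems show ?case
    by (rule exec_CondE) (use CondFalse.hyps(1) in \<open>auto dest: CondFalse.IH\<close>)
next
  case (WhileFalse b s c)
  from WhileFalse.prems show ?case
    by (rule exec_WhileE) (use WhileFalse.hyps(1) in auto)
next
  case (WhileTrue b s c t s' w r)
  from WhileTrue.prems show ?case
    by (rule exec_WhileE) (use WhileTrue.hyps(1) in \<open>auto dest: WhileTrue.IH\<close>)
qed (auto elim: exec_SkipE exec_NAssignE exec_RAssignE)

text \<open>Initially \<open>n\<close> and \<open>m\<close> are in the scalars of these names and all other cells are 0. On
  termination the cell \<open>owner[g]\<close> holds the agent who receives good \<open>g\<close>.\<close>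

definition initial_state :: "nat \<Rightarrow> nat \<Rightarrow> (nat \<Rightarrow> nat \<Rightarrow> real) \<Rightarrow> state" where
  "initial_state n m v =
     \<lparr>matrix = (\<lambda>i g. if i \<in> {1..n} \<and> g \<in> {1..m} then v i g else 0),
      nmem = (\<lambda>a k. if a = ''n'' \<and> k = 0 then n else if a = ''m'' \<and> k = 0 then m else 0),
      rmem = (\<lambda>a k. 0)\<rparr>"

definition output_allocation :: "nat \<Rightarrow> state \<Rightarrow> nat \<Rightarrow> nat set" where
  "output_allocation m s i = {g \<in> {1..m}. nmem s ''owner'' g = i}"

end

theory Submission
  imports Defs
begin

text \<open>
  Envy-cycle elimination, serving the goods in decreasing order of \<open>max\<^sub>i v\<^sub>i(g)\<close>. A good \<open>g\<close> is
  given to an agent who values it and whom no other agent valuing \<open>g\<close> envies; if there is no such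
  agent, the envy graph on the agents valuing \<open>g\<close> has a cycle, and bundles are rotated along it. Own
  values only increase, so for each agent \<open>i\<close> and each bundle \<open>B\<close>, with \<open>h\<close> the last good entering \<open>B\<close>
  that has positive value for \<open>i\<close>, we have \<open>v\<^sub>i(B - h) \<le> v\<^sub>i(A\<^sub>i)\<close>. If \<open>g\<close> is another such
  good of \<open>B\<close>, then \<open>\<gamma> v\<^sub>i(h) \<le> v\<^sub>i(g)\<close> by the order, and \<open>v\<^sub>i(g) \<le> v\<^sub>i(B - h) \<le> v\<^sub>i(A\<^sub>i)\<close>, so
  \<open>2\<gamma> v\<^sub>i(B - g) \<le> 2\<gamma> v\<^sub>i(A\<^sub>i) + (2 - 2\<gamma>) v\<^sub>i(g) \<le> v\<^sub>i(A\<^sub>i + g)\<close> for \<open>\<gamma> \<le> 1/2\<close>,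
  and \<open>v\<^sub>i(B - g) \<le> v\<^sub>i(A\<^sub>i) + (1/\<gamma> - 1) v\<^sub>i(g) \<le> v\<^sub>i(A\<^sub>i + g)\<close> otherwise.
  A rotation keeps the set of bundles and lowers the number of pairs of an agent and a strictly
  preferred bundle, which is at most \<open>n\<^sup>2\<close>; hence there are polynomially many rounds.
\<close>

section \<open>Timed total correctness\<close>

text \<open>The variable stands for a common bound on the rounds of every loop, so the degree is the
  nesting depth of the loops. A conditional pays for both branches, since the sum, unlike the
  maximum, is again a polynomial.\<close>

fun time_poly :: "com \<Rightarrow> nat poly" where
  "time_poly Skip = [:1:]"
| "time_poly (NAssign a i e) = [:1 + ncost i + ncost e:]"
| "time_poly (RAssign a i e) = [:1 + ncost i + rcost e:]"
| "time_poly (Seq c d) = time_poly c + time_poly d"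
| "time_poly (Cond b c d) = [:1 + bcost b:] + time_poly c + time_poly d"
| "time_poly (While b c) = [:1 + bcost b:] + [:0, 1:] * ([:1 + bcost b:] + time_poly c)"

text \<open>The parameter \<open>K\<close> bounds the number of iterations of each single loop.\<close>

definition runs :: "nat \<Rightarrow> com \<Rightarrow> state \<Rightarrow> (state \<Rightarrow> bool) \<Rightarrow> bool" where
  "runs K c s Q \<longleftrightarrow> (\<exists>t s'. exec c s t s' \<and> t \<le> poly (time_poly c) K \<and> Q s')"

fun writes :: "com \<Rightarrow> string set" where
  "writes Skip = {}"
| "writes (NAssign a i e) = {a}"
| "writes (RAssign a i e) = {a}"
| "writes (Seq c d) = writes c \<union> writes d"
| "writes (Cond b c d) = writes c \<union> writes d"
| "writes (While b c) = writes c"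

definition frame :: "string set \<Rightarrow> state \<Rightarrow> state \<Rightarrow> bool" where
  "frame X s s' \<longleftrightarrow> matrix s' = matrix s \<and>
     (\<forall>a. a \<notin> X \<longrightarrow> nmem s' a = nmem s a \<and> rmem s' a = rmem s a)"

section \<open>Frames and proof rules for the single commands\<close>

lemma frame_trans: "frame X s s' \<Longrightarrow> frame X s' s'' \<Longrightarrow> frame X s s''"
  by (simp add: frame_def)

lemma frame_mono: "frame X s s' \<Longrightarrow> X \<subseteq> Y \<Longrightarrow> frame Y s s'"
  by (auto simp: frame_def)

lemma frame_matrix: "frame X s s' \<Longrightarrow> matrix s' = matrix s"
  and frame_nmem: "frame X s s' \<Longrightarrow> a \<notin> X \<Longrightarrow> nmem s' a = nmem s a"
  and frame_rmem: "frame X s s' \<Longrightarrow> a \<notin> X \<Longrightarrow> rmem s' a = rmem s a"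
  by (auto simp: frame_def)

lemma nupdate_simps [simp]:
  "matrix (nupdate a k x s) = matrix s"
  "rmem (nupdate a k x s) = rmem s"
  "nmem (nupdate a k x s) = (nmem s)(a := (nmem s a)(k := x))"
  by (simp_all add: nupdate_def)

lemma rupdate_simps [simp]:
  "matrix (rupdate a k x s) = matrix s"
  "nmem (rupdate a k x s) = nmem s"
  "rmem (rupdate a k x s) = (rmem s)(a := (rmem s a)(k := x))"
  by (simp_all add: rupdate_def)

lemma exec_frame: "exec c s t s' \<Longrightarrow> frame (writes c) s s'"
proof (induction rule: exec.induct)
  case (Seq c s t s' d u s'')
  then show ?case by (simp add: frame_def)
next
  case (WhileTrue b s c t s' u s'')
  then show ?case by (auto intro: frame_trans)
qed (auto simp: frame_def)

text \<open>Because the frame is available when a postcondition is weakened, a specification need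
  mention only the arrays that its command changes.\<close>

lemma runs_conseq: "runs K c s Q \<Longrightarrow> (\<And>s'. frame (writes c) s s' \<Longrightarrow> Q s' \<Longrightarrow> R s') \<Longrightarrow> runs K c s R"
  unfolding runs_def using exec_frame by blast

lemma runs_Skip: "Q s \<Longrightarrow> runs K Skip s Q"
  unfolding runs_def using exec.Skip by fastforce

lemma runs_NAssign: "Q (nupdate a (neval i s) (neval e s) s) \<Longrightarrow> runs K (NAssign a i e) s Q"
  unfolding runs_def by (intro exI conjI, rule exec.NAssign) auto

lemma runs_RAssign: "Q (rupdate a (neval i s) (reval e s) s) \<Longrightarrow> runs K (RAssign a i e) s Q"
  unfolding runs_def by (intro exI conjI, rule exec.RAssign) auto

lemma runs_Seq: "runs K c s (\<lambda>s'. runs K d s' Q) \<Longrightarrow> runs K (Seq c d) s Q"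
  unfolding runs_def by (fastforce intro: exec.Seq)

lemma runs_Cond:
  assumes "beval b s \<Longrightarrow> runs K c s Q" and "\<not> beval b s \<Longrightarrow> runs K d s Q"
  shows "runs K (Cond b c d) s Q"
proof (cases "beval b s")
  case True
  with assms obtain t s' where e: "exec c s t s'" and t: "t \<le> poly (time_poly c) K" "Q s'"
    by (auto simp: runs_def)
  with exec.CondTrue[OF True e] show ?thesis
    unfolding runs_def by (intro exI[of _ "1 + bcost b + t"] exI[of _ s']) auto
next
  case False
  with assms obtain t s' where e: "exec d s t s'" and t: "t \<le> poly (time_poly d) K" "Q s'"
    by (auto simp: runs_def)
  with exec.CondFalse[OF False e] show ?thesis
    unfolding runs_def by (intro exI[of _ "1 + bcost b + t"] exI[of _ s']) auto
qed

text \<open>A strictly decreasing natural measure limits the rounds by its initial value, and a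
  round costs at most one guard and one run of the body.\<close>

lemma runs_While:
  fixes \<mu> :: "state \<Rightarrow> nat"
  assumes "I s" and "\<mu> s \<le> K"
    and body: "\<And>s. I s \<Longrightarrow> beval b s \<Longrightarrow> runs K c s (\<lambda>s'. I s' \<and> \<mu> s' < \<mu> s)"
    and post: "\<And>s. I s \<Longrightarrow> \<not> beval b s \<Longrightarrow> Q s"
  shows "runs K (While b c) s Q"
proof -
  let ?B = "1 + bcost b + poly (time_poly c) K"
  \<comment> \<open>Rounds are charged to \<open>\<mu> s\<close>, which shrinks along the induction;
    the uniform bound \<open>K\<close> enters only at the end.\<close>
  have "\<exists>t s'. exec (While b c) s t s' \<and> t \<le> 1 + bcost b + \<mu> s * ?B \<and> Q s'"
    using \<open>I s\<close>
  proof (induction "\<mu> s" arbitrary: s rule: less_induct)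
    case less
    show ?case
    proof (cases "beval b s")
      case False
      with less.prems post exec.WhileFalse[OF False] show ?thesis
        by (intro exI[of _ "1 + bcost b"] exI[of _ s]) auto
    next
      case True
      with less.prems body obtain t s' where e: "exec c s t s'" "t \<le> poly (time_poly c) K"
        and s': "I s'" "\<mu> s' < \<mu> s"
        unfolding runs_def by meson
      from less.hyps[OF s'(2,1)] obtain u s'' where u: "exec (While b c) s' u s''"
        "u \<le> 1 + bcost b + \<mu> s' * ?B" "Q s''" by blast
      \<comment> \<open>One unit of the drop in \<open>\<mu>\<close> pays for the present guard and
        body.\<close>
      have "Suc (\<mu> s') * ?B \<le> \<mu> s * ?B"
        using s'(2) by (intro mult_right_mono) auto
      then have "1 + bcost b + t + u \<le> 1 + bcost b + \<mu> s * ?B"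
        using e(2) u(2) by simp
      with exec.WhileTrue[OF True e(1) u(1)] u(3) show ?thesis by blast
    qed
  qed
  moreover have "\<mu> s * ?B \<le> K * ?B"
    using \<open>\<mu> s \<le> K\<close> by (rule mult_right_mono) simp
  ultimately show ?thesis
    unfolding runs_def by (fastforce simp: algebra_simps)
qed

section \<open>Derived syntax and counting loops\<close>

abbreviation NVar :: "string \<Rightarrow> nexp" where "NVar a \<equiv> NGet a (NConst 0)"
abbreviation RVar :: "string \<Rightarrow> rexp" where "RVar a \<equiv> RGet a (NConst 0)"
abbreviation NSet :: "string \<Rightarrow> nexp \<Rightarrow> com" where "NSet a e \<equiv> NAssign a (NConst 0) e"
abbreviation RSet :: "string \<Rightarrow> rexp \<Rightarrow> com" where "RSet a e \<equiv> RAssign a (NConst 0) e"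
abbreviation NEq :: "nexp \<Rightarrow> nexp \<Rightarrow> bexp" where
  "NEq e f \<equiv> BAnd (BNot (NLess e f)) (BNot (NLess f e))"
abbreviation If1 :: "bexp \<Rightarrow> com \<Rightarrow> com" where "If1 b c \<equiv> Cond b c Skip"

definition For :: "string \<Rightarrow> string \<Rightarrow> com \<Rightarrow> com" where
  "For x b c = Seq (NSet x (NConst 1)) (While (BNot (NLess (NVar b) (NVar x)))
     (Seq c (NSet x (NAdd (NVar x) (NConst 1)))))"

lemma writes_For [simp]: "writes (For x b c) = insert x (writes c)"
  by (auto simp: For_def)

lemma runs_If1:
  "(beval b s \<Longrightarrow> runs K c s Q) \<Longrightarrow> (\<not> beval b s \<Longrightarrow> Q s) \<Longrightarrow> runs K (If1 b c) s Q"
  by (rule runs_Cond) (auto intro: runs_Skip)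

text \<open>The invariant \<open>I k\<close> holds after \<open>k\<close> rounds; the loop variable is one ahead of \<open>k\<close>.\<close>

lemma runs_For:
  assumes N: "nmem s b 0 = N" "N \<le> K"
    and names: "x \<noteq> b" "x \<notin> writes c" "b \<notin> writes c"
    and stable: "\<And>k s y. I k s \<Longrightarrow> I k (nupdate x 0 y s)"
    and init: "I 0 s"
    and body: "\<And>k s'. k < N \<Longrightarrow> frame (insert x (writes c)) s s' \<Longrightarrow> nmem s' x 0 = Suc k \<Longrightarrow>
      I k s' \<Longrightarrow> runs K c s' (I (Suc k))"
    and post: "\<And>s'. frame (insert x (writes c)) s s' \<Longrightarrow> I N s' \<Longrightarrow> Q s'"
  shows "runs K (For x b c) s Q"
proof -
  let ?X = "insert x (writes c)"
  define J where "J s' \<longleftrightarrow> frame ?X s s' \<and> (\<exists>k\<le>N. nmem s' x 0 = Suc k \<and> I k s')" for s'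
  have bN: "nmem s' b 0 = N" if "J s'" for s'
    using that names N by (auto simp: J_def dest!: frame_nmem[where a = b])
  show ?thesis
    unfolding For_def
  proof (intro runs_Seq runs_NAssign runs_While[where I = J and \<mu> = "\<lambda>s'. Suc N - nmem s' x 0"])
    show "J (nupdate x (neval (NConst 0) s) (neval (NConst 1) s) s)"
      using init stable by (auto simp: J_def frame_def)
    \<comment> \<open>The measure is the number of remaining rounds: \<open>N\<close> when the
      counter is 1, and 0 at the exit value \<open>N + 1\<close>.\<close>
    show "Suc N - nmem (nupdate x (neval (NConst 0) s) (neval (NConst 1) s) s) x 0 \<le> K"
      using N by simp
  next
    fix r assume J: "J r" and "beval (BNot (NLess (NVar b) (NVar x))) r"
    then obtain k where k: "k < N" "nmem r x 0 = Suc k" "I k r" "frame ?X s r"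
      using bN by (auto simp: J_def)
    show "runs K c r (\<lambda>s'. runs K (NSet x (NAdd (NVar x) (NConst 1))) s'
        (\<lambda>s'. J s' \<and> Suc N - nmem s' x 0 < Suc N - nmem r x 0))"
    proof (rule runs_conseq[OF body[OF k(1,4,2,3)]])
      fix q assume q: "frame (writes c) r q" "I (Suc k) q"
      have f: "frame ?X s q"
        using frame_trans[OF k(4) frame_mono[OF q(1)]] by blast
      have "nmem q x 0 = Suc k"
        using q(1) names k by (simp add: frame_nmem)
      \<comment> \<open>The body establishes the invariant before the counter moves;
        \<open>stable\<close> carries it across the increment.\<close>
      moreover have "J (nupdate x 0 (Suc (Suc k)) q)"
        using f k stable[OF q(2)] by (auto simp: J_def frame_def)
      ultimately show "runs K (NSet x (NAdd (NVar x) (NConst 1))) q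
          (\<lambda>s'. J s' \<and> Suc N - nmem s' x 0 < Suc N - nmem r x 0)"
        using k by (intro runs_NAssign) auto
    qed
  next
    fix r assume "J r" "\<not> beval (BNot (NLess (NVar b) (NVar x))) r"
    then show "Q r"
      using bN[of r] post[of r] by (auto simp: J_def less_Suc_eq_le dest: le_antisym)
  qed
qed

section \<open>Envy-cycle elimination on owner functions\<close>

definition share :: "nat \<Rightarrow> (nat \<Rightarrow> nat) \<Rightarrow> nat \<Rightarrow> nat set" where
  "share m own i = {g \<in> {1..m}. own g = i}"

text \<open>The owners are forgotten on purpose: passing bundles around a cycle leaves this set
  unchanged.\<close>

definition bundles :: "nat \<Rightarrow> nat \<Rightarrow> (nat \<Rightarrow> nat) \<Rightarrow> nat set set" where
  "bundles n m own = share m own ` {1..n}"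

text \<open>Both the denominator of \<open>good_range\<close> and the key by which goods are
  served.\<close>

definition top_value :: "nat \<Rightarrow> (nat \<Rightarrow> nat \<Rightarrow> real) \<Rightarrow> nat \<Rightarrow> real" where
  "top_value n v g = Max ((\<lambda>i. v i g) ` {1..n})"

definition envies :: "nat \<Rightarrow> (nat \<Rightarrow> nat \<Rightarrow> real) \<Rightarrow> (nat \<Rightarrow> nat) \<Rightarrow> nat \<Rightarrow> nat \<Rightarrow> bool" where
  "envies m v own i j \<longleftrightarrow> val v i (share m own i) < val v i (share m own j)"

text \<open>The witness \<open>h\<close> is the good of positive value for \<open>i\<close> that entered the bundle last.\<close>

definition fair_except_last :: "nat \<Rightarrow> nat \<Rightarrow> (nat \<Rightarrow> nat \<Rightarrow> real) \<Rightarrow> (nat \<Rightarrow> nat) \<Rightarrow> bool" where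
  "fair_except_last n m v own \<longleftrightarrow>
     (\<forall>i\<in>{1..n}. \<forall>b\<in>bundles n m own. b \<inter> pos_goods m v i \<noteq> {} \<longrightarrow>
        (\<exists>h\<in>b \<inter> pos_goods m v i. val v i (b - {h}) \<le> val v i (share m own i) \<and>
           (\<forall>g\<in>b \<inter> pos_goods m v i. top_value n v h \<le> top_value n v g)))"

text \<open>Agents are numbered from 1, so owner 0, the initial content of memory, marks a good not
  yet served. The last conjunct records the order of service; it makes a newly served good the
  smallest of its bundle.\<close>

definition partial_allocation :: "nat \<Rightarrow> nat \<Rightarrow> (nat \<Rightarrow> nat \<Rightarrow> real) \<Rightarrow> (nat \<Rightarrow> nat) \<Rightarrow> bool" where
  "partial_allocation n m v own \<longleftrightarrow> (\<forall>g\<in>{1..m}. own g \<le> n) \<and> fair_except_last n m v own \<and>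
     (\<forall>g\<in>{1..m}. \<forall>h\<in>{1..m}. own g \<noteq> 0 \<longrightarrow> own h = 0 \<longrightarrow> top_value n v h \<le> top_value n v g)"

definition unassigned :: "nat \<Rightarrow> (nat \<Rightarrow> nat) \<Rightarrow> nat set" where
  "unassigned m own = {g \<in> {1..m}. own g = 0}"

text \<open>Counting preferred bundles instead of envied agents makes the count depend only on the
  set of bundles and on the own values.\<close>

definition envy_count :: "nat \<Rightarrow> nat \<Rightarrow> (nat \<Rightarrow> nat \<Rightarrow> real) \<Rightarrow> (nat \<Rightarrow> nat) \<Rightarrow> nat" where
  "envy_count n m v own =
     (\<Sum>i=1..n. card {b \<in> bundles n m own. val v i (share m own i) < val v i b})"

section \<open>Basic facts on shares, bundles and top values\<close>

lemma finite_share [simp]: "finite (share m own i)"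
  by (simp add: share_def)

lemma share_subset: "share m own i \<subseteq> {1..m}"
  by (auto simp: share_def)

lemma finite_bundles [simp]: "finite (bundles n m own)"
  by (simp add: bundles_def)

lemma envy_count_le: "envy_count n m v own \<le> n * n"
proof -
  have "card {b \<in> bundles n m own. val v i (share m own i) < val v i b} \<le> n" for i
  proof -
    have "card {b \<in> bundles n m own. val v i (share m own i) < val v i b} \<le> card (bundles n m own)"
      by (rule card_mono) auto
    also have "\<dots> \<le> n"
      unfolding bundles_def using card_image_le[of "{1..n}" "share m own"] by simp
    finally show ?thesis .
  qed
  then show ?thesis
    unfolding envy_count_def using sum_bounded_above[of "{1..n}" _ n] by simp
qed

lemma top_value_ge: "i \<in> {1..n} \<Longrightarrow> v i g \<le> top_value n v g"
  unfolding top_value_def by (rule Max_ge) auto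

lemma top_value_attained: "n \<ge> 1 \<Longrightarrow> \<exists>i\<in>{1..n}. v i g = top_value n v g"
proof -
  assume "n \<ge> 1"
  then have "top_value n v g \<in> (\<lambda>i. v i g) ` {1..n}"
    unfolding top_value_def by (intro Max_in) auto
  then show ?thesis by auto
qed

lemma last_good:
  assumes "partial_allocation n m v own" and "i \<in> {1..n}" and "b \<in> bundles n m own"
    and "b \<inter> pos_goods m v i \<noteq> {}"
  shows "\<exists>h\<in>b \<inter> pos_goods m v i. val v i (b - {h}) \<le> val v i (share m own i) \<and>
    (\<forall>g\<in>b \<inter> pos_goods m v i. top_value n v h \<le> top_value n v g)"
proof -
  from assms(1) have "fair_except_last n m v own"
    by (simp only: partial_allocation_def)
  from this[unfolded fair_except_last_def, THEN bspec, OF assms(2), THEN bspec, OF assms(3),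
      THEN mp, OF assms(4)]
  show ?thesis .
qed

section \<open>Preservation of the invariant under reassignment and service\<close>

text \<open>The abstract effect of a rotation: bundles change hands as wholes, and the served goods
  stay the same.\<close>

definition reassigned :: "nat \<Rightarrow> nat \<Rightarrow> (nat \<Rightarrow> nat) \<Rightarrow> (nat \<Rightarrow> nat) \<Rightarrow> bool" where
  "reassigned n m own own' \<longleftrightarrow> bundles n m own' = bundles n m own \<and>
     (\<forall>g\<in>{1..m}. own' g \<le> n \<and> (own' g = 0 \<longleftrightarrow> own g = 0))"

lemma unassigned_reassigned: "reassigned n m own own' \<Longrightarrow> unassigned m own' = unassigned m own"
  by (auto simp: reassigned_def unassigned_def)

text \<open>The witness \<open>h\<close> belongs to a bundle and an agent, not to the holder of the
  bundle. Own values only rise, so the old witness still works.\<close>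

lemma partial_allocation_reassigned:
  assumes "partial_allocation n m v own" and re: "reassigned n m own own'"
    and up: "\<And>i. i \<in> {1..n} \<Longrightarrow> val v i (share m own i) \<le> val v i (share m own' i)"
  shows "partial_allocation n m v own'"
proof -
  have "fair_except_last n m v own'"
    unfolding fair_except_last_def
  proof (intro ballI impI)
    fix i b assume i: "i \<in> {1..n}" and b: "b \<in> bundles n m own'" "b \<inter> pos_goods m v i \<noteq> {}"
    have "b \<in> bundles n m own"
      using b(1) re by (simp add: reassigned_def)
    from last_good[OF assms(1) i this b(2)] obtain h where h: "h \<in> b \<inter> pos_goods m v i"
      and le: "val v i (b - {h}) \<le> val v i (share m own i)"
      and "\<forall>g\<in>b \<inter> pos_goods m v i. top_value n v h \<le> top_value n v g"
      by blast
    with order_trans[OF le up[OF i]] show "\<exists>h\<in>b \<inter> pos_goods m v i. val v i (b - {h}) \<le> val v i (share m own' i) \<and>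
        (\<forall>g\<in>b \<inter> pos_goods m v i. top_value n v h \<le> top_value n v g)"
      by blast
  qed
  with assms(1) re show ?thesis
    by (simp add: partial_allocation_def reassigned_def)
qed

text \<open>With the bundles fixed, a higher own value can only shrink the set of preferred bundles.
  For \<open>c\<close> it shrinks properly: the bundle just received was preferred before and is not
  any more.\<close>

lemma envy_count_reassigned:
  assumes re: "reassigned n m own own'"
    and up: "\<And>i. i \<in> {1..n} \<Longrightarrow> val v i (share m own i) \<le> val v i (share m own' i)"
    and c: "c \<in> {1..n}" "val v c (share m own c) < val v c (share m own' c)"
  shows "envy_count n m v own' < envy_count n m v own"
proof -
  have b: "bundles n m own' = bundles n m own"
    using re by (simp add: reassigned_def)
  let ?E = "\<lambda>own' i. {b \<in> bundles n m own. val v i (share m own' i) < val v i b}"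
  have "(\<Sum>i=1..n. card (?E own' i)) < (\<Sum>i=1..n. card (?E own i))"
  proof (rule sum_strict_mono_ex1)
    show "\<forall>i\<in>{1..n}. card (?E own' i) \<le> card (?E own i)"
      by (intro ballI card_mono) (use up in \<open>fastforce+\<close>)
    have "share m own' c \<in> bundles n m own"
      using b c(1) unfolding bundles_def by blast
    then have "share m own' c \<in> ?E own c - ?E own' c"
      using c(2) by simp
    moreover have "?E own' c \<subseteq> ?E own c"
      using c(2) by auto
    ultimately have "?E own' c \<subset> ?E own c"
      by blast
    then show "\<exists>i\<in>{1..n}. card (?E own' i) < card (?E own i)"
      using c(1) by (intro bexI[of _ c] psubset_card_mono) auto
  qed simp
  then show ?thesis
    by (simp add: envy_count_def b)
qed

lemma unassigned_update:
  assumes "cur \<in> unassigned m own" and "k \<noteq> 0"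
  shows "card (unassigned m (own(cur := k))) < card (unassigned m own)"
  using assms by (intro psubset_card_mono) (auto simp: unassigned_def split: if_splits)

text \<open>For agents who value \<open>cur\<close>, it becomes the last good in the bundle of
  \<open>k\<close>: without it the old bundle remains, which by \<open>unenvied\<close> they do not
  prefer to their own. All other pairs of agent and bundle keep their witness, as \<open>cur\<close>
  adds value 0 or the bundle is unchanged.\<close>

lemma partial_allocation_update:
  assumes inst: "fair_division_instance n m v" and part: "partial_allocation n m v own"
    and cur: "cur \<in> unassigned m own"
    and top: "\<And>g. g \<in> unassigned m own \<Longrightarrow> top_value n v g \<le> top_value n v cur"
    and k: "k \<in> {1..n}"
    and unenvied: "\<And>i. i \<in> {1..n} \<Longrightarrow> v i cur > 0 \<Longrightarrow> \<not> envies m v own i k"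
  shows "partial_allocation n m v (own(cur := k))"
proof -
  let ?own = "own(cur := k)"
  have cur_m: "cur \<in> {1..m}" "own cur = 0"
    using cur by (auto simp: unassigned_def)
  have share_k: "share m ?own k = insert cur (share m own k)" and cur_k: "cur \<notin> share m own k"
    using cur_m k by (auto simp: share_def)
  have share_j: "share m ?own j = share m own j" if "j \<in> {1..n}" "j \<noteq> k" for j
    using that cur_m by (auto simp: share_def)
  have nonneg: "v i g \<ge> 0" if "i \<in> {1..n}" "g \<in> {1..m}" for i g
    using inst that by (auto simp: fair_division_instance_def)
  have up: "val v i (share m own i) \<le> val v i (share m ?own i)" if "i \<in> {1..n}" for i
    using that nonneg[OF that cur_m(1)] share_k share_j[OF that] cur_k
    by (cases "i = k") (auto simp: val_def)
  have "fair_except_last n m v ?own"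
    unfolding fair_except_last_def
  proof (intro ballI impI)
    fix i b assume i: "i \<in> {1..n}" and b: "b \<in> bundles n m ?own" "b \<inter> pos_goods m v i \<noteq> {}"
    from b(1) obtain j where j: "j \<in> {1..n}" "b = share m ?own j" by (auto simp: bundles_def)
    show "\<exists>h\<in>b \<inter> pos_goods m v i. val v i (b - {h}) \<le> val v i (share m ?own i) \<and>
        (\<forall>g\<in>b \<inter> pos_goods m v i. top_value n v h \<le> top_value n v g)"
    proof (cases "j = k \<and> v i cur > 0")
      case True
      have "val v i (b - {cur}) = val v i (share m own k)"
        using True j share_k cur_k by simp
      also have "\<dots> \<le> val v i (share m ?own i)"
        using unenvied[OF i] up[OF i] True by (simp add: envies_def)
      finally have 1: "val v i (b - {cur}) \<le> val v i (share m ?own i)" .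
      have 2: "top_value n v cur \<le> top_value n v g" if "g \<in> b \<inter> pos_goods m v i" for g
      proof (cases "g = cur")
        \<comment> \<open>\<open>g\<close> was served before \<open>cur\<close>, so the order clause
          of the invariant compares the two.\<close>
        case False
        then have "g \<in> {1..m}" "own g \<noteq> 0"
          using that j True k by (auto simp: share_def)
        then show ?thesis
          using part cur_m by (auto simp: partial_allocation_def)
      qed simp
      have "cur \<in> b \<inter> pos_goods m v i"
        using True j cur_m by (auto simp: share_k pos_goods_def)
      with 1 2 show ?thesis by blast
    next
      case False
      let ?b = "share m own j"
      have b_eq: "b \<inter> pos_goods m v i = ?b \<inter> pos_goods m v i"
        using False j share_k share_j[OF j(1)] by (cases "j = k") (auto simp: pos_goods_def)
      have "?b \<in> bundles n m own" using j by (simp add: bundles_def)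
      from last_good[OF part i this] b(2) b_eq obtain h where h: "h \<in> ?b \<inter> pos_goods m v i"
        "val v i (?b - {h}) \<le> val v i (share m own i)"
        "\<forall>g\<in>?b \<inter> pos_goods m v i. top_value n v h \<le> top_value n v g"
        by auto
      have "val v i (b - {h}) = val v i (?b - {h})"
      proof (cases "j = k")
        case True
        then have "v i cur = 0"
          using False nonneg[OF i cur_m(1)] by simp
        moreover have "b - {h} = insert cur (?b - {h})"
          using True j share_k h(1) cur_k by auto
        ultimately show ?thesis
          using cur_k True by (simp add: val_def)
      next
        case False
        then show ?thesis using share_j[OF j(1)] j(2) by simp
      qed
      with h up[OF i] show ?thesis
        unfolding b_eq by (intro bexI[of _ h]) auto
    qed
  qed
  with part k cur_m top show ?thesis
    unfolding partial_allocation_def unassigned_def by auto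
qed

section \<open>From the invariant to approximate fairness\<close>

text \<open>The good \<open>g\<close>, valued by \<open>i\<close>, keeps all the minima nonempty.
  Since \<gamma> is at most the ratio for \<open>g\<close>, whose numerator is at most
  \<open>v i g\<close>, clearing the denominator gives the last bound; it yields \<gamma> \<le> 1
  because \<open>v i g\<close> is at most the top value.\<close>

lemma range_param_bounds:
  assumes inst: "fair_division_instance n m v"
    and i: "i \<in> {1..n}" and g: "g \<in> {1..m}" "v i g > 0"
  shows "0 < range_param n m v" "range_param n m v \<le> 1"
    "range_param n m v * top_value n v g \<le> v i g"
proof -
  let ?low = "\<lambda>g. Min ((\<lambda>j. v j g) ` {j \<in> {1..n}. v j g > 0})"
  have pos: "\<exists>j\<in>{1..n}. v j g > 0" if "g \<in> {1..m}" for g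
    using inst that by (auto simp: fair_division_instance_def)
  have top: "0 < top_value n v g" if "g \<in> {1..m}" for g
    using pos[OF that] top_value_ge by (meson less_le_trans)
  have low: "0 < ?low g" if "g \<in> {1..m}" for g
    using pos[OF that] by (subst Min_gr_iff) auto
  have gr: "good_range n v g = ?low g / top_value n v g" for g
    by (simp add: good_range_def top_value_def)
  have "good_range n v g > 0" if "g \<in> {1..m}" for g
    using low[OF that] top[OF that] by (simp add: gr)
  moreover have "range_param n m v \<in> good_range n v ` {1..m}"
    unfolding range_param_def using g(1) by (intro Min_in) auto
  ultimately show "0 < range_param n m v" by auto
  have "range_param n m v \<le> good_range n v g"
    unfolding range_param_def using g(1) by (intro Min_le) auto
  then have "range_param n m v * top_value n v g \<le> ?low g"
    using top[OF g(1)] by (simp add: gr field_simps)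
  also have "\<dots> \<le> v i g"
    using i g(2) by (intro Min_le) auto
  finally show le: "range_param n m v * top_value n v g \<le> v i g" .
  then have "range_param n m v * top_value n v g \<le> 1 * top_value n v g"
    using top_value_ge[OF i, of v g] by simp
  with top[OF g(1)] show "range_param n m v \<le> 1"
    by (simp only: mult_le_cancel_right)
qed

lemma partial_allocation_is_tEFx:
  assumes inst: "fair_division_instance n m v" and part: "partial_allocation n m v own"
    and all: "unassigned m own = {}"
  shows "is_tEFx (2 * range_param n m v) n m v (share m own)"
proof -
  define \<gamma> where "\<gamma> = range_param n m v"
  \<comment> \<open>The minimum merges the two cases of the convention: a factor above 1 is replaced
    by 1.\<close>
  define \<alpha> where "\<alpha> = min 1 (2 * \<gamma>)"
  have "(\<Union>i\<in>{1..n}. share m own i) = {1..m}"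
    using part all by (force simp: share_def partial_allocation_def unassigned_def)
  then have "is_allocation n m (share m own)"
    by (auto simp: is_allocation_def share_def)
  moreover have "tEFx_ineq \<alpha> n m v (share m own)"
    unfolding tEFx_ineq_def
  proof (intro ballI)
    fix i j g
    assume i: "i \<in> {1..n}" and j: "j \<in> {1..n}" and g: "g \<in> share m own j \<inter> pos_goods m v i"
    let ?x = "val v i (share m own i)" and ?b = "share m own j"
    have gm: "g \<in> {1..m}" and gpos: "v i g > 0"
      using g by (auto simp: pos_goods_def)
    have nonneg: "v i h \<ge> 0" if "h \<in> {1..m}" for h
      using inst i that by (auto simp: fair_division_instance_def)
    have \<gamma>: "0 < \<gamma>" "\<gamma> \<le> 1" "\<gamma> * top_value n v g \<le> v i g"
      using range_param_bounds[OF inst i gm gpos] by (simp_all add: \<gamma>_def)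
    have \<alpha>: "0 \<le> \<alpha>" "\<alpha> \<le> 1" "\<alpha> \<le> 2 * \<gamma>"
      using \<gamma> by (auto simp: \<alpha>_def)
    have x: "0 \<le> ?x"
      using nonneg share_subset unfolding val_def by (intro sum_nonneg) blast
    have "?b \<in> bundles n m own" using j by (simp add: bundles_def)
    from last_good[OF part i this] obtain h where h: "h \<in> ?b \<inter> pos_goods m v i"
      "val v i (?b - {h}) \<le> ?x" "top_value n v h \<le> top_value n v g"
      using g by blast
    have remove: "val v i (?b - {a}) = val v i ?b - v i a" if "a \<in> ?b" for a
      using that by (simp add: val_def sum_diff1)
    have "\<alpha> * val v i (?b - {g}) \<le> val v i (share m own i \<union> {g})"
    proof (cases "i = j")
      \<comment> \<open>The pair \<open>i = j\<close> falls under the definition too; there, adding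
        \<open>g\<close> gives back the own bundle.\<close>
      case True
      have "val v i (?b - {g}) \<le> ?x"
        using remove g gpos True by simp
      moreover have "\<alpha> * val v i (?b - {g}) \<le> val v i (?b - {g})"
        using \<alpha> nonneg share_subset unfolding val_def
        by (intro mult_left_le_one_le sum_nonneg) blast+
      moreover have "share m own i \<union> {g} = share m own i"
        using g True by auto
      ultimately show ?thesis by simp
    next
      case False
      have "g \<notin> share m own i"
        using g False by (auto simp: share_def)
      then have xg: "val v i (share m own i \<union> {g}) = ?x + v i g"
        by (simp add: val_def)
      \<comment> \<open>By additivity, leaving out \<open>g\<close> instead of \<open>h\<close>
        changes the value by \<open>v i h - v i g\<close>.\<close>
      have bg: "val v i (?b - {g}) \<le> ?x + (v i h - v i g)"
        using h(1,2) g remove by simp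
      show ?thesis
      proof (cases "h = g")
        case True
        then have "\<alpha> * val v i (?b - {g}) \<le> \<alpha> * ?x"
          using h \<alpha> by (intro mult_left_mono) auto
        also have "\<dots> \<le> ?x" using \<alpha> x by (simp add: mult_left_le_one_le)
        finally show ?thesis using xg gpos by simp
      next
        case False
        \<comment> \<open>\<open>g\<close> survives the removal of \<open>h\<close>, so
          \<open>v i g\<close> is at most the own value; this is what the case
          \<open>2 * \<gamma> \<le> 1\<close> lives on.\<close>
        have "v i g \<le> val v i (?b - {h})"
          unfolding val_def
        proof (rule member_le_sum)
          show "g \<in> ?b - {h}" using g False by simp
          show "0 \<le> v i a" if "a \<in> ?b - {h} - {g}" for a
            using nonneg[of a] that by (simp add: share_def)
        qed simp
        then have gx: "v i g \<le> ?x" using h(2) by simp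
        \<comment> \<open>The order of service enters here: \<open>h\<close> came last, so its top
          value is at most that of \<open>g\<close>.\<close>
        have "\<gamma> * v i h \<le> \<gamma> * top_value n v g"
          using h(3) top_value_ge[OF i, of v h] \<gamma> by (intro mult_left_mono) auto
        then have hg: "\<gamma> * v i h \<le> v i g" using \<gamma>(3) by simp
        have "\<alpha> * (?x + (v i h - v i g)) \<le> ?x + v i g"
        proof (cases "2 * \<gamma> \<le> 1")
          case True
          then have \<alpha>_eq: "\<alpha> = 2 * \<gamma>" by (simp add: \<alpha>_def)
          \<comment> \<open>Once \<open>\<gamma> * v i h\<close> is replaced by
            \<open>v i g\<close>, the claim reduces to this inequality.\<close>
          have "(1 - 2 * \<gamma>) * v i g \<le> (1 - 2 * \<gamma>) * ?x"
            using True gx by (intro mult_left_mono) auto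
          then show ?thesis using hg by (simp add: \<alpha>_eq algebra_simps)
        next
          case False
          then have \<alpha>_eq: "\<alpha> = 1" by (simp add: \<alpha>_def)
          have "v i h \<ge> 0" using h(1) by (auto simp: pos_goods_def)
          \<comment> \<open>With factor 1 it is enough that
            \<open>v i h \<le> 2 * v i g\<close>.\<close>
          then have "(1/2) * v i h \<le> \<gamma> * v i h"
            using False by (intro mult_right_mono) auto
          then show ?thesis using hg by (simp add: \<alpha>_eq)
        qed
        moreover have "\<alpha> * val v i (?b - {g}) \<le> \<alpha> * (?x + (v i h - v i g))"
          using bg \<alpha> by (intro mult_left_mono) auto
        ultimately show ?thesis using xg by simp
      qed
    qed
    then show "\<alpha> * val v i (?b - {g}) \<le> val v i (share m own i \<union> {g})" .
  qed
  ultimately show ?thesis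
    by (auto simp: is_tEFx_def \<alpha>_def \<gamma>_def min_def split: if_splits)
qed

section \<open>Cycles of a self-map and rotation along them\<close>

text \<open>Among the \<open>n + 1\<close> iterates of \<open>s\<close> two coincide by the
  pigeonhole principle, so after \<open>n\<close> steps any tail is left behind and \<open>c\<close>
  lies on a cycle. Its least period is \<open>p\<close>.\<close>

lemma exists_period:
  fixes f :: "nat \<Rightarrow> nat"
  assumes f: "\<And>x. x \<in> T \<Longrightarrow> f x \<in> T" and T: "T \<subseteq> {1..n}" and s: "s \<in> T" and c: "c = (f ^^ n) s"
  obtains p where "0 < p" "p \<le> n" "(f ^^ p) c = c" "\<And>q. 0 < q \<Longrightarrow> q < p \<Longrightarrow> (f ^^ q) c \<noteq> c"
proof -
  have "(f ^^ k) s \<in> T" for k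
    by (induction k) (use f s in auto)
  then have "(\<lambda>k. (f ^^ k) s) ` {0..n} \<subseteq> {1..n}" using T by auto
  then have "\<not> inj_on (\<lambda>k. (f ^^ k) s) {0..n}"
    using card_inj_on_le[of "\<lambda>k. (f ^^ k) s" "{0..n}" "{1..n}"] by auto
  then obtain a b where ab: "a < b" "b \<le> n" "(f ^^ a) s = (f ^^ b) s"
    unfolding inj_on_def by (metis atLeastAtMost_iff linorder_neqE_nat)
  \<comment> \<open>As \<open>a \<le> n\<close>, the coincidence at \<open>a\<close> and
    \<open>b\<close> can be moved forward by \<open>n - a\<close> steps, which turns it into a
    return to \<open>c\<close>.\<close>
  have "(f ^^ (b - a)) c = (f ^^ (b - a + n)) s"
    by (simp add: c funpow_add)
  also have "b - a + n = (n - a) + b" using ab by simp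
  also have "(f ^^ \<dots>) s = (f ^^ (n - a + a)) s"
    by (simp only: funpow_add comp_apply ab)
  also have "\<dots> = c" using ab by (simp add: c)
  finally have per: "0 < b - a \<and> (f ^^ (b - a)) c = c" using ab by simp
  define p where "p = (LEAST q. 0 < q \<and> (f ^^ q) c = c)"
  have "0 < p \<and> (f ^^ p) c = c" unfolding p_def using per by (rule LeastI)
  moreover have "p \<le> b - a" unfolding p_def using per by (rule Least_le)
  moreover have "(f ^^ q) c \<noteq> c" if "0 < q" "q < p" for q
    using not_less_Least[of q "\<lambda>q. 0 < q \<and> (f ^^ q) c = c"] that unfolding p_def by blast
  ultimately show ?thesis using that[of p] ab by auto
qed

text \<open>Two equal iterates, moved forward by \<open>p - b\<close> steps, would give a return to
  \<open>c\<close> after \<open>p - b + a < p\<close> steps.\<close>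

lemma funpow_distinct:
  fixes f :: "nat \<Rightarrow> nat"
  assumes per: "(f ^^ p) c = c" and least: "\<And>q. 0 < q \<Longrightarrow> q < p \<Longrightarrow> (f ^^ q) c \<noteq> c"
    and "a < b" "b < p"
  shows "(f ^^ a) c \<noteq> (f ^^ b) c"
proof
  assume eq: "(f ^^ a) c = (f ^^ b) c"
  have "(f ^^ (p - b + a)) c = (f ^^ (p - b + b)) c"
    by (simp only: funpow_add comp_apply eq)
  also have "\<dots> = c" using per \<open>b < p\<close> by simp
  finally have cyc: "(f ^^ (p - b + a)) c = c" .
  have "0 < p - b + a" "p - b + a < p"
    using \<open>a < b\<close> \<open>b < p\<close> by linarith+
  from least[OF this] cyc show False by contradiction
qed

definition swapped :: "nat \<Rightarrow> nat \<Rightarrow> nat \<Rightarrow> (nat \<Rightarrow> nat) \<Rightarrow> (nat \<Rightarrow> nat) \<Rightarrow> bool" where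
  "swapped m c y own own' \<longleftrightarrow>
     (\<forall>g\<in>{1..m}. own' g = (if own g = c then y else if own g = y then c else own g))"

lemma share_swapped:
  assumes "swapped m c y own own'"
  shows "share m own' = (share m own)(c := share m own y, y := share m own c)"
proof
  fix j show "share m own' j = ((share m own)(c := share m own y, y := share m own c)) j"
    using assms by (auto simp: swapped_def share_def split: if_splits)
qed

text \<open>Both \<open>c\<close> and \<open>y\<close> are agents, so the exchange permutes the
  bundles and no good gains or loses owner 0.\<close>

lemma reassigned_swapped:
  assumes "reassigned n m own0 own" and sw: "swapped m c y own own'" and "c \<in> {1..n}" "y \<in> {1..n}"
  shows "reassigned n m own0 own'"
proof -
  have "bundles n m own' = bundles n m own"
    unfolding bundles_def share_swapped[OF sw] using assms(3,4) by (auto simp: image_iff)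
  with assms show ?thesis
    by (auto simp: reassigned_def swapped_def)
qed

text \<open>A cycle \<open>c, f c, \<dots>\<close> is rotated by swapping \<open>c\<close> with \<open>f c\<close>, \<open>f (f c)\<close> and so on; agent \<open>c\<close>
  holds the bundle in transit. This is the situation after \<open>r\<close> swaps.\<close>

definition rotated :: "nat \<Rightarrow> (nat \<Rightarrow> nat) \<Rightarrow> nat \<Rightarrow> (nat \<Rightarrow> nat) \<Rightarrow> nat \<Rightarrow> (nat \<Rightarrow> nat) \<Rightarrow> bool" where
  "rotated m f c own0 r own \<longleftrightarrow> share m own c = share m own0 ((f ^^ r) c) \<and>
     (\<forall>s<r. share m own ((f ^^ Suc s) c) = share m own0 ((f ^^ s) c)) \<and>
     (\<forall>x. x \<notin> (\<lambda>s. (f ^^ s) c) ` {..r} \<longrightarrow> share m own x = share m own0 x)"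

lemma rotated_0: "rotated m f c own 0 own"
  by (simp add: rotated_def)

text \<open>Below the period the next agent on the cycle has not taken part yet and still holds its
  original bundle. The swap hands it the bundle in transit and puts its own into transit.\<close>

lemma rotated_Suc:
  assumes rot: "rotated m f c own0 r own" and sw: "swapped m c ((f ^^ Suc r) c) own own'"
    and per: "(f ^^ p) c = c" and least: "\<And>q. 0 < q \<Longrightarrow> q < p \<Longrightarrow> (f ^^ q) c \<noteq> c" and "Suc r < p"
  shows "rotated m f c own0 (Suc r) own'"
proof -
  let ?y = "(f ^^ Suc r) c"
  have distinct: "?y \<noteq> (f ^^ s) c" if "s \<le> r" for s
    using funpow_distinct[OF per least, of s "Suc r"] that \<open>Suc r < p\<close> by force
  have y: "?y \<noteq> c" using distinct[of 0] by simp
  have share_y: "share m own ?y = share m own0 ?y"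
    using rot distinct unfolding rotated_def by blast
  note [simp] = share_swapped[OF sw]
  show ?thesis
    unfolding rotated_def
  proof (intro conjI allI impI)
    show "share m own' c = share m own0 ?y" using y share_y by simp
  next
    fix s assume "s < Suc r"
    show "share m own' ((f ^^ Suc s) c) = share m own0 ((f ^^ s) c)"
    proof (cases "s = r")
      case True
      then show ?thesis using rot by (simp add: rotated_def)
    next
      case False
      with \<open>s < Suc r\<close> have "s < r" by simp
      moreover have "(f ^^ Suc s) c \<noteq> ?y" using distinct[of "Suc s"] \<open>s < r\<close> by simp
      moreover have "(f ^^ Suc s) c \<noteq> c" using least[of "Suc s"] \<open>s < r\<close> \<open>Suc r < p\<close> by simp
      ultimately show ?thesis using rot by (simp add: rotated_def)
    qed
  next
    fix x assume x: "x \<notin> (\<lambda>s. (f ^^ s) c) ` {..Suc r}"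
    then have "x \<noteq> ?y" "x \<noteq> (f ^^ 0) c" by blast+
    moreover have "x \<notin> (\<lambda>s. (f ^^ s) c) ` {..r}" using x by auto
    ultimately show "share m own' x = share m own0 x"
      using rot by (simp add: rotated_def)
  qed
qed

text \<open>When the walk closes up, the bundle in transit comes from the predecessor of
  \<open>c\<close>, so it may stay there. Every agent on the cycle then holds the bundle of its
  predecessor, which it envied.\<close>

lemma rotated_improves:
  assumes rot: "rotated m f c own0 r own" and per: "(f ^^ Suc r) c = c"
    and envy: "\<And>s. envies m v own0 ((f ^^ Suc s) c) ((f ^^ s) c)"
  shows "val v i (share m own0 i) \<le> val v i (share m own i)"
    and "val v c (share m own0 c) < val v c (share m own c)"
proof -
  show c: "val v c (share m own0 c) < val v c (share m own c)"
    using envy[of r] rot per by (simp add: envies_def rotated_def)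
  show "val v i (share m own0 i) \<le> val v i (share m own i)"
  proof (cases "i \<in> (\<lambda>s. (f ^^ s) c) ` {..r}")
    case False
    then show ?thesis using rot by (simp add: rotated_def)
  next
    case True
    then obtain s where s: "s \<le> r" "i = (f ^^ s) c" by auto
    show ?thesis
    proof (cases s)
      case 0
      then show ?thesis using s c by simp
    next
      case (Suc q)
      then show ?thesis using s envy[of q] rot by (simp add: envies_def rotated_def)
    qed
  qed
qed

section \<open>The program\<close>

text \<open>\<open>acc\<close> sums up the value of the bundle of \<open>j\<close> minus that of
  \<open>i\<close>, so its sign decides envy. The conditionals are independent: for
  \<open>i = j\<close> both fire and cancel.\<close>

definition envy_test :: com where
  "envy_test = Seq (RSet ''acc'' (RConst 0)) (For ''h'' ''m'' (Seq
     (If1 (NEq (NGet ''owner'' (NVar ''h'')) (NVar ''j''))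
       (RSet ''acc'' (RAdd (RVar ''acc'') (RVal (NVar ''i'') (NVar ''h'')))))
     (If1 (NEq (NGet ''owner'' (NVar ''h'')) (NVar ''i''))
       (RSet ''acc'' (RSub (RVar ''acc'') (RVal (NVar ''i'') (NVar ''h'')))))))"

text \<open>Edges point from the envied agent to an envier: \<open>f[j]\<close> is an agent valuing
  \<open>cur\<close> who envies \<open>j\<close>, or 0 if there is none.\<close>

definition find_envier :: com where
  "find_envier = Seq (NAssign ''f'' (NVar ''j'') (NConst 0)) (For ''i'' ''n''
     (If1 (RLess (RConst 0) (RVal (NVar ''i'') (NVar ''cur''))) (Seq envy_test
       (If1 (RLess (RConst 0) (RVar ''acc'')) (NAssign ''f'' (NVar ''j'') (NVar ''i''))))))"

text \<open>\<open>src\<close> is an unenvied candidate for \<open>cur\<close>, or 0;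
  \<open>start\<close> is any candidate, from which the walk to a cycle begins if there is no
  source.\<close>

definition find_source :: com where
  "find_source = Seq (NSet ''src'' (NConst 0)) (For ''j'' ''n''
     (If1 (RLess (RConst 0) (RVal (NVar ''j'') (NVar ''cur''))) (Seq find_envier (Seq
       (NSet ''start'' (NVar ''j''))
       (If1 (NLess (NGet ''f'' (NVar ''j'')) (NConst 1)) (NSet ''src'' (NVar ''j'')))))))"

definition enter_cycle :: com where
  "enter_cycle = Seq (NSet ''c'' (NVar ''start'')) (For ''k'' ''n''
     (NSet ''c'' (NGet ''f'' (NVar ''c''))))"

definition swap_owners :: com where
  "swap_owners = For ''h'' ''m'' (Cond (NEq (NGet ''owner'' (NVar ''h'')) (NVar ''c''))
     (NAssign ''owner'' (NVar ''h'') (NVar ''y''))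
     (If1 (NEq (NGet ''owner'' (NVar ''h'')) (NVar ''y''))
       (NAssign ''owner'' (NVar ''h'') (NVar ''c''))))"

definition rotate_cycle :: com where
  "rotate_cycle = Seq (NSet ''y'' (NGet ''f'' (NVar ''c'')))
     (While (BNot (NEq (NVar ''y'') (NVar ''c'')))
       (Seq swap_owners (NSet ''y'' (NGet ''f'' (NVar ''y'')))))"

text \<open>Every good is worth something to somebody, so with \<open>best\<close> starting at 0 and
  a strict test, \<open>cur\<close> stays 0 only if all goods are served.\<close>

definition pick_good :: com where
  "pick_good = Seq (NSet ''cur'' (NConst 0)) (Seq (RSet ''best'' (RConst 0)) (For ''g'' ''m''
     (If1 (NLess (NGet ''owner'' (NVar ''g'')) (NConst 1)) (For ''i'' ''n''
       (If1 (RLess (RVar ''best'') (RVal (NVar ''i'') (NVar ''g'')))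
         (Seq (RSet ''best'' (RVal (NVar ''i'') (NVar ''g''))) (NSet ''cur'' (NVar ''g''))))))))"

text \<open>A rotation leaves the good unserved; it is picked again and tried with a smaller envy
  count.\<close>

definition serve_good :: com where
  "serve_good = Seq find_source (Cond (NLess (NConst 0) (NVar ''src''))
     (NAssign ''owner'' (NVar ''cur'') (NVar ''src'')) (Seq enter_cycle rotate_cycle))"

definition program :: com where
  "program = Seq pick_good (While (NLess (NConst 0) (NVar ''cur'')) (Seq serve_good pick_good))"

section \<open>Correctness of the subroutines\<close>

lemma writes_simps [simp]:
  "writes envy_test = {''acc'', ''h''}"
  "writes find_envier = {''f'', ''i'', ''acc'', ''h''}"
  "writes find_source = {''src'', ''j'', ''f'', ''i'', ''acc'', ''h'', ''start''}"
  "writes enter_cycle = {''c'', ''k''}"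
  "writes swap_owners = {''h'', ''owner''}"
  "writes rotate_cycle = {''y'', ''h'', ''owner''}"
  "writes pick_good = {''cur'', ''best'', ''g'', ''i''}"
  "writes serve_good =
     {''src'', ''j'', ''f'', ''i'', ''acc'', ''h'', ''start'', ''owner'', ''c'', ''k'', ''y''}"
  by (auto simp: envy_test_def find_envier_def find_source_def enter_cycle_def swap_owners_def
      rotate_cycle_def pick_good_def serve_good_def)

definition dims :: "nat \<Rightarrow> nat \<Rightarrow> (nat \<Rightarrow> nat \<Rightarrow> real) \<Rightarrow> state \<Rightarrow> bool" where
  "dims n m v s \<longleftrightarrow> nmem s ''n'' 0 = n \<and> nmem s ''m'' 0 = m \<and> matrix s = v"

lemma dims_frame: "frame X s s' \<Longrightarrow> ''n'' \<notin> X \<Longrightarrow> ''m'' \<notin> X \<Longrightarrow> dims n m v s' = dims n m v s"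
  by (simp add: dims_def frame_matrix frame_nmem)

text \<open>The number of goods doubles as a loop counter: after \<open>k\<close> rounds a loop over
  the goods has seen exactly \<open>share k\<close>.\<close>

lemma val_share_Suc:
  "val v i (share (Suc k) own j) = val v i (share k own j) + (if own (Suc k) = j then v i (Suc k) else 0)"
proof -
  have "share (Suc k) own j = (if own (Suc k) = j then insert (Suc k) else id) (share k own j)"
    by (auto simp: share_def le_Suc_eq)
  moreover have "Suc k \<notin> share k own j" by (simp add: share_def)
  ultimately show ?thesis by (simp add: val_def)
qed

lemma runs_envy_test:
  assumes "dims n m v s" "m \<le> K"
  shows "runs K envy_test s (\<lambda>s'. 0 < rmem s' ''acc'' 0 \<longleftrightarrow>
    envies m v (nmem s ''owner'') (nmem s ''i'' 0) (nmem s ''j'' 0))"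
proof -
  let ?i = "nmem s ''i'' 0" and ?j = "nmem s ''j'' 0" and ?own = "nmem s ''owner''"
  let ?I = "\<lambda>k s'. rmem s' ''acc'' 0 = val v ?i (share k ?own ?j) - val v ?i (share k ?own ?i)"
  let ?add = "If1 (NEq (NGet ''owner'' (NVar ''h'')) (NVar ''j''))
    (RSet ''acc'' (RAdd (RVar ''acc'') (RVal (NVar ''i'') (NVar ''h''))))"
  let ?sub = "If1 (NEq (NGet ''owner'' (NVar ''h'')) (NVar ''i''))
    (RSet ''acc'' (RSub (RVar ''acc'') (RVal (NVar ''i'') (NVar ''h''))))"
  show ?thesis
    unfolding envy_test_def
  proof (rule runs_Seq, rule runs_RAssign, rule runs_For[where N = m and I = ?I])
    let ?s = "rupdate ''acc'' (neval (NConst 0) s) (reval (RConst 0) s) s"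
    show "?I 0 ?s" by (simp add: val_def share_def)
    fix k r
    assume fr: "frame (insert ''h'' (writes (Seq ?add ?sub))) ?s r"
      and h: "nmem r ''h'' 0 = Suc k" and I: "?I k r"
    have r: "matrix r = v" "nmem r ''i'' = nmem s ''i''" "nmem r ''j'' = nmem s ''j''"
      "nmem r ''owner'' = ?own"
      using fr assms by (simp_all add: dims_def frame_matrix frame_nmem)
    show "runs K (Seq ?add ?sub) r (?I (Suc k))"
      by (intro runs_Seq runs_If1 runs_RAssign) (auto simp: r h I val_share_Suc)
  next
    fix r assume "?I m r"
    then show "0 < rmem r ''acc'' 0 \<longleftrightarrow> envies m v ?own ?i ?j"
      by (simp add: envies_def)
  qed (use assms in \<open>simp_all add: dims_def\<close>)
qed

text \<open>The meaning of a cell \<open>f[j]\<close>. With the first argument read as the number of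
  agents inspected so far, it is also the invariant of the search.\<close>

definition is_envier ::
  "nat \<Rightarrow> nat \<Rightarrow> (nat \<Rightarrow> nat \<Rightarrow> real) \<Rightarrow> (nat \<Rightarrow> nat) \<Rightarrow> nat \<Rightarrow> nat \<Rightarrow> nat \<Rightarrow> bool" where
  "is_envier n m v own cur j x \<longleftrightarrow>
     (if x = 0 then \<forall>i\<in>{1..n}. v i cur > 0 \<longrightarrow> \<not> envies m v own i j
      else x \<in> {1..n} \<and> v x cur > 0 \<and> envies m v own x j)"

text \<open>That the other cells of \<open>f\<close> are kept lets the enclosing search collect the
  edges of all agents.\<close>

lemma runs_find_envier:
  assumes "dims n m v s" "n \<le> K" "m \<le> K"
  shows "runs K find_envier s (\<lambda>s'. (\<forall>x. x \<noteq> nmem s ''j'' 0 \<longrightarrow> nmem s' ''f'' x = nmem s ''f'' x) \<and>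
    is_envier n m v (nmem s ''owner'') (nmem s ''cur'' 0) (nmem s ''j'' 0)
      (nmem s' ''f'' (nmem s ''j'' 0)))"
proof -
  let ?j = "nmem s ''j'' 0" and ?own = "nmem s ''owner''" and ?cur = "nmem s ''cur'' 0"
  let ?I = "\<lambda>k s'. (\<forall>x. x \<noteq> ?j \<longrightarrow> nmem s' ''f'' x = nmem s ''f'' x) \<and>
    is_envier k m v ?own ?cur ?j (nmem s' ''f'' ?j)"
  have Suc_k: "is_envier (Suc k) m v ?own ?cur ?j x"
    if "is_envier k m v ?own ?cur ?j x" "v (Suc k) ?cur > 0 \<Longrightarrow> \<not> envies m v ?own (Suc k) ?j" for k x
    using that by (auto simp: is_envier_def le_Suc_eq split: if_splits)
  have Suc_k': "is_envier (Suc k) m v ?own ?cur ?j (Suc k)"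
    if "v (Suc k) ?cur > 0" "envies m v ?own (Suc k) ?j" for k
    using that by (simp add: is_envier_def)
  show ?thesis
    unfolding find_envier_def
  proof (rule runs_Seq, rule runs_NAssign, rule runs_For[where N = n and I = ?I])
    let ?s = "nupdate ''f'' (neval (NVar ''j'') s) (neval (NConst 0) s) s"
    show "?I 0 ?s" by (simp add: is_envier_def)
    fix k r
    assume fr: "frame (insert ''i'' (writes (If1 (RLess (RConst 0) (RVal (NVar ''i'') (NVar ''cur'')))
        (Seq envy_test (If1 (RLess (RConst 0) (RVar ''acc''))
          (NAssign ''f'' (NVar ''j'') (NVar ''i''))))))) ?s r"
      and i: "nmem r ''i'' 0 = Suc k" and I: "?I k r" and k: "k < n"
    have r: "dims n m v r" "nmem r ''j'' 0 = ?j" "nmem r ''cur'' 0 = ?cur" "nmem r ''owner'' = ?own"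
      using fr assms by (simp_all add: dims_def frame_matrix frame_nmem)
    show "runs K (If1 (RLess (RConst 0) (RVal (NVar ''i'') (NVar ''cur''))) (Seq envy_test
        (If1 (RLess (RConst 0) (RVar ''acc'')) (NAssign ''f'' (NVar ''j'') (NVar ''i''))))) r (?I (Suc k))"
    proof (rule runs_If1)
      assume "\<not> beval (RLess (RConst 0) (RVal (NVar ''i'') (NVar ''cur''))) r"
      then show "?I (Suc k) r"
        using I Suc_k r i by (simp add: dims_def)
    next
      assume pos: "beval (RLess (RConst 0) (RVal (NVar ''i'') (NVar ''cur''))) r"
      show "runs K (Seq envy_test (If1 (RLess (RConst 0) (RVar ''acc''))
          (NAssign ''f'' (NVar ''j'') (NVar ''i'')))) r (?I (Suc k))"
      proof (rule runs_Seq, rule runs_conseq[OF runs_envy_test[OF r(1) assms(3)]])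
        fix q assume q: "frame (writes envy_test) r q"
          "0 < rmem q ''acc'' 0 \<longleftrightarrow> envies m v (nmem r ''owner'') (nmem r ''i'' 0) (nmem r ''j'' 0)"
        then have "nmem q ''f'' = nmem r ''f''" "nmem q ''i'' 0 = Suc k" "nmem q ''j'' 0 = ?j"
          by (simp_all add: frame_nmem i r)
        with q(2) show "runs K (If1 (RLess (RConst 0) (RVar ''acc''))
            (NAssign ''f'' (NVar ''j'') (NVar ''i''))) q (?I (Suc k))"
          using I Suc_k pos r i
          by (intro runs_If1 runs_NAssign) (simp_all add: dims_def Suc_k')
      qed
    qed
  qed (use assms in \<open>simp_all add: dims_def\<close>)
qed

lemma runs_find_source:
  assumes "dims n m v s" "n \<le> K" "m \<le> K"
    and pos: "\<exists>i\<in>{1..n}. v i (nmem s ''cur'' 0) > 0"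
  shows "runs K find_source s (\<lambda>s'.
    (if nmem s' ''src'' 0 = 0
     then \<forall>j\<in>{1..n}. v j (nmem s ''cur'' 0) > 0 \<longrightarrow> nmem s' ''f'' j \<noteq> 0 \<and>
       is_envier n m v (nmem s ''owner'') (nmem s ''cur'' 0) j (nmem s' ''f'' j)
     else nmem s' ''src'' 0 \<in> {1..n} \<and>
       is_envier n m v (nmem s ''owner'') (nmem s ''cur'' 0) (nmem s' ''src'' 0) 0) \<and>
    nmem s' ''start'' 0 \<in> {1..n} \<and> v (nmem s' ''start'' 0) (nmem s ''cur'' 0) > 0)"
proof -
  let ?own = "nmem s ''owner''" and ?cur = "nmem s ''cur'' 0"
  \<comment> \<open>Once a source is known, nothing about \<open>f\<close> need be remembered. The
    clause on \<open>start\<close> is conditional, as the first \<open>k\<close> agents may all be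
    indifferent to the good; \<open>pos\<close> settles it at the end.\<close>
  let ?I = "\<lambda>k s'. (if nmem s' ''src'' 0 = 0
     then \<forall>j\<in>{1..k}. v j ?cur > 0 \<longrightarrow> nmem s' ''f'' j \<noteq> 0 \<and>
       is_envier n m v ?own ?cur j (nmem s' ''f'' j)
     else nmem s' ''src'' 0 \<in> {1..n} \<and> is_envier n m v ?own ?cur (nmem s' ''src'' 0) 0) \<and>
    ((\<exists>i\<in>{1..k}. v i ?cur > 0) \<longrightarrow> nmem s' ''start'' 0 \<in> {1..n} \<and> v (nmem s' ''start'' 0) ?cur > 0)"
  let ?body = "Seq find_envier (Seq (NSet ''start'' (NVar ''j''))
     (If1 (NLess (NGet ''f'' (NVar ''j'')) (NConst 1)) (NSet ''src'' (NVar ''j''))))"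
  let ?c = "If1 (RLess (RConst 0) (RVal (NVar ''j'') (NVar ''cur''))) ?body"
  show ?thesis
    unfolding find_source_def
  proof (rule runs_Seq, rule runs_NAssign, rule runs_For[where N = n and I = ?I])
    let ?s = "nupdate ''src'' (neval (NConst 0) s) (neval (NConst 0) s) s"
    show "?I 0 ?s" by simp
    show "?I k (nupdate ''j'' 0 y r)" if "?I k r" for k r y
      using that by (cases "nmem r ''src'' 0 = 0") simp_all
    fix k r
    assume fr: "frame (insert ''j'' (writes ?c)) ?s r"
      and j: "nmem r ''j'' 0 = Suc k" and I: "?I k r" and k: "k < n"
    have r: "dims n m v r" "nmem r ''cur'' 0 = ?cur" "nmem r ''owner'' = ?own"
      using fr assms by (simp_all add: dims_def frame_matrix frame_nmem)
    show "runs K ?c r (?I (Suc k))"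
    proof (rule runs_If1)
      assume "\<not> beval (RLess (RConst 0) (RVal (NVar ''j'') (NVar ''cur''))) r"
      then show "?I (Suc k) r"
        using I r j by (auto simp: dims_def le_Suc_eq)
    next
      assume "beval (RLess (RConst 0) (RVal (NVar ''j'') (NVar ''cur''))) r"
      then have vj: "v (Suc k) ?cur > 0" using r j by (simp add: dims_def)
      show "runs K ?body r (?I (Suc k))"
      proof (rule runs_Seq, rule runs_conseq[OF runs_find_envier[OF r(1) assms(2,3)]])
        fix q assume q: "frame (writes find_envier) r q" and f: "(\<forall>x. x \<noteq> nmem r ''j'' 0 \<longrightarrow>
            nmem q ''f'' x = nmem r ''f'' x) \<and>
          is_envier n m v (nmem r ''owner'') (nmem r ''cur'' 0) (nmem r ''j'' 0)
            (nmem q ''f'' (nmem r ''j'' 0))"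
        have "nmem q ''src'' 0 = nmem r ''src'' 0" "nmem q ''j'' 0 = Suc k"
          using q by (simp_all add: frame_nmem j)
        then show "runs K (Seq (NSet ''start'' (NVar ''j''))
            (If1 (NLess (NGet ''f'' (NVar ''j'')) (NConst 1)) (NSet ''src'' (NVar ''j'')))) q (?I (Suc k))"
          using f vj k I j r
          by (intro runs_Seq runs_NAssign runs_If1) (auto simp: le_Suc_eq)
      qed
    qed
  next
    fix r assume "?I n r"
    with pos show "(if nmem r ''src'' 0 = 0
       then \<forall>j\<in>{1..n}. v j ?cur > 0 \<longrightarrow> nmem r ''f'' j \<noteq> 0 \<and>
         is_envier n m v ?own ?cur j (nmem r ''f'' j)
       else nmem r ''src'' 0 \<in> {1..n} \<and> is_envier n m v ?own ?cur (nmem r ''src'' 0) 0) \<and>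
      nmem r ''start'' 0 \<in> {1..n} \<and> v (nmem r ''start'' 0) ?cur > 0"
      by blast
  qed (use assms in \<open>simp_all add: dims_def\<close>)
qed

lemma runs_enter_cycle:
  assumes "dims n m v s" "n \<le> K"
  shows "runs K enter_cycle s (\<lambda>s'. nmem s' ''c'' 0 = (nmem s ''f'' ^^ n) (nmem s ''start'' 0))"
  unfolding enter_cycle_def
  by (rule runs_Seq, rule runs_NAssign, rule runs_For[where N = n and
        I = "\<lambda>k s'. nmem s' ''c'' 0 = (nmem s ''f'' ^^ k) (nmem s ''start'' 0)"])
    (use assms in \<open>auto simp: dims_def frame_nmem intro!: runs_NAssign\<close>)

lemma runs_swap_owners:
  assumes "dims n m v s" "m \<le> K"
  shows "runs K swap_owners s (\<lambda>s'. swapped m (nmem s ''c'' 0) (nmem s ''y'' 0)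
    (nmem s ''owner'') (nmem s' ''owner''))"
proof -
  let ?c = "nmem s ''c'' 0" and ?y = "nmem s ''y'' 0" and ?own = "nmem s ''owner''"
  \<comment> \<open>Cells beyond \<open>k\<close> are still original, so each good is tested against
    its old owner.\<close>
  let ?I = "\<lambda>k s'. swapped k ?c ?y ?own (nmem s' ''owner'') \<and>
    (\<forall>g>k. nmem s' ''owner'' g = ?own g)"
  let ?body = "Cond (NEq (NGet ''owner'' (NVar ''h'')) (NVar ''c''))
     (NAssign ''owner'' (NVar ''h'') (NVar ''y''))
     (If1 (NEq (NGet ''owner'' (NVar ''h'')) (NVar ''y''))
       (NAssign ''owner'' (NVar ''h'') (NVar ''c'')))"
  show ?thesis
    unfolding swap_owners_def
  proof (rule runs_For[where N = m and I = ?I])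
    show "?I 0 s" by (simp add: swapped_def)
    fix k r
    assume fr: "frame (insert ''h'' (writes ?body)) s r"
      and h: "nmem r ''h'' 0 = Suc k" and I: "?I k r"
    have r: "nmem r ''c'' = nmem s ''c''" "nmem r ''y'' = nmem s ''y''"
      using fr by (simp_all add: frame_nmem)
    show "runs K ?body r (?I (Suc k))"
      using I by (intro runs_Cond runs_If1 runs_NAssign runs_Skip)
        (auto simp: r h swapped_def le_Suc_eq)
  qed (use assms in \<open>simp_all add: dims_def\<close>)
qed

text \<open>\<open>T\<close> stands for the candidates for the good. \<open>f\<close> maps it into
  itself along envy, so the walk from \<open>a\<close> ends on an envy cycle inside
  \<open>T\<close>.\<close>

lemma runs_rotate_cycle:
  assumes s: "dims n m v s" "n \<le> K" "m \<le> K"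
    and own0: "\<forall>g\<in>{1..m}. nmem s ''owner'' g \<le> n"
    and T: "T \<subseteq> {1..n}" "\<And>x. x \<in> T \<Longrightarrow> nmem s ''f'' x \<in> T"
    and envy: "\<And>x. x \<in> T \<Longrightarrow> envies m v (nmem s ''owner'') (nmem s ''f'' x) x"
    and c: "a \<in> T" "nmem s ''c'' 0 = (nmem s ''f'' ^^ n) a"
  shows "runs K rotate_cycle s (\<lambda>s'. reassigned n m (nmem s ''owner'') (nmem s' ''owner'') \<and>
    (\<forall>i. val v i (share m (nmem s ''owner'') i) \<le> val v i (share m (nmem s' ''owner'') i)) \<and>
    (\<exists>i\<in>{1..n}. val v i (share m (nmem s ''owner'') i) < val v i (share m (nmem s' ''owner'') i)))"
proof -
  define f c own0 where "f = nmem s ''f''" and "c = nmem s ''c'' 0" and "own0 = nmem s ''owner''"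
  obtain p where p: "0 < p" "p \<le> n" "(f ^^ p) c = c"
    and least: "\<And>q. 0 < q \<Longrightarrow> q < p \<Longrightarrow> (f ^^ q) c \<noteq> c"
    using exists_period[OF T(2) T(1) c] unfolding f_def c_def by blast
  have "(f ^^ r) a \<in> T" for r
    by (induction r) (use c(1) T(2) in \<open>auto simp: f_def\<close>)
  from this[of "r + n" for r] have fT: "(f ^^ r) c \<in> T" for r
    using c(2) by (simp add: f_def c_def funpow_add)
  then have envy_c: "envies m v own0 ((f ^^ Suc r) c) ((f ^^ r) c)" for r
    using envy by (simp add: f_def own0_def)
  have c_n: "c \<in> {1..n}" using fT[of 0] T(1) by auto
  define J where "J s' \<longleftrightarrow> frame {''y'', ''h'', ''owner''} s s' \<and>
    reassigned n m own0 (nmem s' ''owner'') \<and>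
    (\<exists>r<p. nmem s' ''y'' 0 = (f ^^ Suc r) c \<and> rotated m f c own0 r (nmem s' ''owner''))" for s' :: state
  \<comment> \<open>The program stores no count of the swaps made; it is recovered from the position
    of \<open>y\<close> on the cycle.\<close>
  define \<mu> where "\<mu> s' = p - (THE r. r < p \<and> nmem s' ''y'' 0 = (f ^^ Suc r) c)" for s' :: state
  have the_r: "(THE r. r < p \<and> nmem s' ''y'' 0 = (f ^^ Suc r) c) = r"
    if "r < p" "nmem s' ''y'' 0 = (f ^^ Suc r) c" for r and s' :: state
  proof (rule the_equality)
    fix q assume q: "q < p \<and> nmem s' ''y'' 0 = (f ^^ Suc q) c"
    show "q = r"
    proof (rule ccontr)
      \<comment> \<open>The exponents run through \<open>1..p\<close>. The last point is
        \<open>c\<close> itself, separated from the others by minimality of \<open>p\<close>; the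
        rest are distinct iterates below the period.\<close>
      have False if "q < r" "r < p" "(f ^^ Suc q) c = (f ^^ Suc r) c" for q r
      proof (cases "Suc r = p")
        case True
        then show False using that p(3) least[of "Suc q"] by force
      next
        case False
        then show False using that funpow_distinct[OF p(3) least, of "Suc q" "Suc r"] by force
      qed
      moreover assume "q \<noteq> r"
      ultimately show False using q that by (metis linorder_neqE_nat)
    qed
  qed (use that in simp)
  show ?thesis
    unfolding rotate_cycle_def f_def[symmetric] c_def[symmetric] own0_def[symmetric]
  proof (rule runs_Seq, rule runs_NAssign, rule runs_While[where I = J and \<mu> = \<mu>])
    let ?s = "nupdate ''y'' (neval (NConst 0) s) (neval (NGet ''f'' (NVar ''c'')) s) s"
    have "reassigned n m own0 own0"
      using own0 by (simp add: reassigned_def own0_def)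
    then show "J ?s"
      unfolding J_def using p(1) rotated_0[of m f c own0]
      by (auto simp: frame_def f_def c_def own0_def)
    show "\<mu> ?s \<le> K" using p(2) s(2) by (simp add: \<mu>_def)
  next
    fix r assume "J r" and b: "beval (BNot (NEq (NVar ''y'') (NVar ''c''))) r"
    then obtain t where fr: "frame {''y'', ''h'', ''owner''} s r"
      and re: "reassigned n m own0 (nmem r ''owner'')" and t: "t < p"
      and y: "nmem r ''y'' 0 = (f ^^ Suc t) c" and rot: "rotated m f c own0 t (nmem r ''owner'')"
      by (auto simp: J_def)
    have r: "dims n m v r" "nmem r ''c'' 0 = c" "nmem r ''f'' = f"
      using fr s(1) by (simp_all add: dims_frame frame_nmem c_def f_def)
    \<comment> \<open>The guard says that \<open>y\<close> has not come back to \<open>c\<close>, so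
      one more swap stays below the period.\<close>
    have "Suc t \<noteq> p" using b y r p(3) by auto
    then have St: "Suc t < p" using t by simp
    show "runs K (Seq swap_owners (NSet ''y'' (NGet ''f'' (NVar ''y'')))) r (\<lambda>s'. J s' \<and> \<mu> s' < \<mu> r)"
    proof (rule runs_Seq, rule runs_conseq[OF runs_swap_owners[OF r(1) s(3)]])
      fix q assume q: "frame (writes swap_owners) r q"
        and sw: "swapped m (nmem r ''c'' 0) (nmem r ''y'' 0) (nmem r ''owner'') (nmem q ''owner'')"
      let ?q = "nupdate ''y'' (neval (NConst 0) q) (neval (NGet ''f'' (NVar ''y'')) q) q"
      have sw: "swapped m c ((f ^^ Suc t) c) (nmem r ''owner'') (nmem q ''owner'')"
        using sw y r by simp
      have yq: "nmem ?q ''y'' 0 = (f ^^ Suc (Suc t)) c"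
        using q by (simp add: frame_nmem y r)
      have "frame {''y'', ''h'', ''owner''} s ?q"
        using fr q by (simp add: frame_def)
      moreover have "reassigned n m own0 (nmem q ''owner'')"
        using reassigned_swapped[OF re sw c_n] fT T(1) by blast
      moreover have "rotated m f c own0 (Suc t) (nmem q ''owner'')"
        by (rule rotated_Suc[OF rot sw p(3) least St])
      ultimately have "J ?q"
        unfolding J_def using yq St by auto
      moreover have "\<mu> ?q < \<mu> r"
        unfolding \<mu>_def the_r[OF St yq] the_r[OF t y] using St by simp
      ultimately show "runs K (NSet ''y'' (NGet ''f'' (NVar ''y''))) q (\<lambda>s'. J s' \<and> \<mu> s' < \<mu> r)"
        by (intro runs_NAssign) simp
    qed
  next
    fix r assume "J r" and b: "\<not> beval (BNot (NEq (NVar ''y'') (NVar ''c''))) r"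
    then obtain t where fr: "frame {''y'', ''h'', ''owner''} s r"
      and re: "reassigned n m own0 (nmem r ''owner'')"
      and y: "nmem r ''y'' 0 = (f ^^ Suc t) c" and rot: "rotated m f c own0 t (nmem r ''owner'')"
      by (auto simp: J_def)
    have "(f ^^ Suc t) c = c"
      using b y fr by (simp add: frame_nmem c_def)
    from rotated_improves[OF rot this envy_c] re c_n
    show "reassigned n m own0 (nmem r ''owner'') \<and>
      (\<forall>i. val v i (share m own0 i) \<le> val v i (share m (nmem r ''owner'') i)) \<and>
      (\<exists>i\<in>{1..n}. val v i (share m own0 i) < val v i (share m (nmem r ''owner'') i))"
      by blast
  qed
qed

section \<open>Progress of a round and the main loop\<close>

text \<open>The lexicographic order on unserved goods and envy, flattened to one number: the weight
  exceeds the largest possible \<open>envy_count\<close>.\<close>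

definition work :: "nat \<Rightarrow> nat \<Rightarrow> (nat \<Rightarrow> nat \<Rightarrow> real) \<Rightarrow> (nat \<Rightarrow> nat) \<Rightarrow> nat" where
  "work n m v own = card (unassigned m own) * (n * n + 1) + envy_count n m v own"

definition next_good :: "nat \<Rightarrow> nat \<Rightarrow> (nat \<Rightarrow> nat \<Rightarrow> real) \<Rightarrow> (nat \<Rightarrow> nat) \<Rightarrow> nat \<Rightarrow> bool" where
  "next_good n m v own cur \<longleftrightarrow> (if cur = 0 then unassigned m own = {} else
     cur \<in> unassigned m own \<and>
     (\<forall>g\<in>unassigned m own. top_value n v g \<le> top_value n v cur))"

lemma runs_serve_good:
  assumes s: "dims n m v s" "n \<le> K" "m \<le> K"
    and inst: "fair_division_instance n m v" and part: "partial_allocation n m v (nmem s ''owner'')"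
    and cur: "next_good n m v (nmem s ''owner'') (nmem s ''cur'' 0)" "nmem s ''cur'' 0 \<noteq> 0"
  shows "runs K serve_good s (\<lambda>s'. partial_allocation n m v (nmem s' ''owner'') \<and>
    work n m v (nmem s' ''owner'') < work n m v (nmem s ''owner''))"
proof -
  let ?own = "nmem s ''owner''" and ?cur = "nmem s ''cur'' 0"
  have un: "?cur \<in> unassigned m ?own"
    and top: "\<And>g. g \<in> unassigned m ?own \<Longrightarrow> top_value n v g \<le> top_value n v ?cur"
    using cur by (simp_all add: next_good_def)
  have pos: "\<exists>i\<in>{1..n}. v i ?cur > 0"
    using un inst by (auto simp: unassigned_def fair_division_instance_def)
  let ?post = "\<lambda>s'. partial_allocation n m v (nmem s' ''owner'') \<and>
    work n m v (nmem s' ''owner'') < work n m v ?own"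
  show ?thesis
    unfolding serve_good_def
  proof (rule runs_Seq, rule runs_conseq[OF runs_find_source[where n = n and m = m and v = v,
        OF s pos]])
    fix r
    assume fr: "frame (writes find_source) s r"
    assume src: "(if nmem r ''src'' 0 = 0
        then \<forall>j\<in>{1..n}. v j ?cur > 0 \<longrightarrow> nmem r ''f'' j \<noteq> 0 \<and>
          is_envier n m v ?own ?cur j (nmem r ''f'' j)
        else nmem r ''src'' 0 \<in> {1..n} \<and> is_envier n m v ?own ?cur (nmem r ''src'' 0) 0) \<and>
      nmem r ''start'' 0 \<in> {1..n} \<and> v (nmem r ''start'' 0) ?cur > 0"
    have r: "nmem r ''owner'' = ?own" "nmem r ''cur'' 0 = ?cur" "dims n m v r"
      using fr s(1) by (simp_all add: frame_nmem dims_frame)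
    show "runs K (Cond (NLess (NConst 0) (NVar ''src''))
      (NAssign ''owner'' (NVar ''cur'') (NVar ''src'')) (Seq enter_cycle rotate_cycle)) r ?post"
    proof (rule runs_Cond)
      assume "beval (NLess (NConst 0) (NVar ''src'')) r"
      then have k: "nmem r ''src'' 0 \<in> {1..n}"
        and no_envy: "is_envier n m v ?own ?cur (nmem r ''src'' 0) 0"
        using src by (auto split: if_splits)
      let ?own' = "?own(?cur := nmem r ''src'' 0)"
      have "partial_allocation n m v ?own'"
        using no_envy by (intro partial_allocation_update[OF inst part un top k])
          (simp_all add: is_envier_def)
      \<comment> \<open>Serving a good may create envy, but at most \<open>n * n\<close>, less than
        the weight of one good.\<close>
      moreover have "work n m v ?own' < work n m v ?own"
      proof -
        have "Suc (card (unassigned m ?own')) \<le> card (unassigned m ?own)"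
          using unassigned_update[OF un, of "nmem r ''src'' 0"] k by simp
        then have "Suc (card (unassigned m ?own')) * (n * n + 1) \<le> card (unassigned m ?own) * (n * n + 1)"
          by (rule mult_right_mono) simp
        then show ?thesis
          using envy_count_le[of n m v ?own'] unfolding work_def by simp
      qed
      ultimately show "runs K (NAssign ''owner'' (NVar ''cur'') (NVar ''src'')) r ?post"
        by (intro runs_NAssign) (simp add: r)
    next
      assume "\<not> beval (NLess (NConst 0) (NVar ''src'')) r"
      then have f: "\<And>j. j \<in> {1..n} \<Longrightarrow> v j ?cur > 0 \<Longrightarrow> nmem r ''f'' j \<noteq> 0 \<and>
          is_envier n m v ?own ?cur j (nmem r ''f'' j)"
        and start: "nmem r ''start'' 0 \<in> {1..n}" "v (nmem r ''start'' 0) ?cur > 0"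
        using src by simp_all
      \<comment> \<open>Without a source, each agent valuing \<open>cur\<close> is envied by one
        that values it too, so \<open>f\<close> stays inside \<open>T\<close>.\<close>
      define T where "T = {i \<in> {1..n}. v i ?cur > 0}"
      show "runs K (Seq enter_cycle rotate_cycle) r ?post"
      proof (rule runs_Seq, rule runs_conseq[OF runs_enter_cycle[OF r(3) s(2)]])
        fix q assume q: "frame (writes enter_cycle) r q"
          and c: "nmem q ''c'' 0 = (nmem r ''f'' ^^ n) (nmem r ''start'' 0)"
        have qs: "nmem q ''owner'' = ?own" "nmem q ''f'' = nmem r ''f''" "dims n m v q"
          using q r by (simp_all add: frame_nmem dims_frame)
        show "runs K rotate_cycle q ?post"
        proof (rule runs_conseq[OF runs_rotate_cycle[OF qs(3) s(2,3), of T "nmem r ''start'' 0"]])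
          show "\<forall>g\<in>{1..m}. nmem q ''owner'' g \<le> n"
            using part by (simp add: qs partial_allocation_def)
          show "T \<subseteq> {1..n}" by (auto simp: T_def)
          show "nmem q ''f'' x \<in> T" "envies m v (nmem q ''owner'') (nmem q ''f'' x) x" if "x \<in> T" for x
            using f[of x] that by (auto simp: T_def is_envier_def qs)
          show "nmem r ''start'' 0 \<in> T" using start by (simp add: T_def)
          show "nmem q ''c'' 0 = (nmem q ''f'' ^^ n) (nmem r ''start'' 0)" by (simp add: c qs)
        next
          fix w
          let ?own' = "nmem w ''owner''"
          assume "reassigned n m (nmem q ''owner'') ?own' \<and>
            (\<forall>i. val v i (share m (nmem q ''owner'') i) \<le> val v i (share m ?own' i)) \<and>
            (\<exists>i\<in>{1..n}. val v i (share m (nmem q ''owner'') i) < val v i (share m ?own' i))"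
          then have re: "reassigned n m ?own ?own'"
            and up: "\<And>i. val v i (share m ?own i) \<le> val v i (share m ?own' i)"
            and ex: "\<exists>i\<in>{1..n}. val v i (share m ?own i) < val v i (share m ?own' i)"
            by (simp_all add: qs)
          have "partial_allocation n m v ?own'"
            using part re up by (rule partial_allocation_reassigned)
          moreover have "envy_count n m v ?own' < envy_count n m v ?own"
            using ex envy_count_reassigned[OF re up] by blast
          then have "work n m v ?own' < work n m v ?own"
            using unassigned_reassigned[OF re] by (simp add: work_def)
          ultimately show "?post w" by blast
        qed
      qed
    qed
  qed
qed

text \<open>State of the search for the largest value after inspecting the agent-good pairs in \<open>S\<close>.\<close>

definition best_pair :: "(nat \<Rightarrow> nat \<Rightarrow> real) \<Rightarrow> (nat \<times> nat) set \<Rightarrow> nat \<Rightarrow> real \<Rightarrow> bool" where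
  "best_pair v S cur best \<longleftrightarrow> (\<forall>(i, g)\<in>S. v i g \<le> best) \<and>
     (cur = 0 \<and> best = 0 \<or> 0 < best \<and> cur \<noteq> 0 \<and> (\<exists>i. (i, cur) \<in> S \<and> best = v i cur))"

text \<open>\<open>best\<close> is never negative, so a strict improvement is positive and may serve
  as the new champion.\<close>

lemma best_pair_insert:
  assumes "best_pair v S cur best" "g \<noteq> 0"
  shows "best < v i g \<Longrightarrow> best_pair v (insert (i, g) S) g (v i g)"
    and "\<not> best < v i g \<Longrightarrow> best_pair v (insert (i, g) S) cur best"
proof -
  have le: "v j h \<le> best" if "(j, h) \<in> S" for j h
    using assms(1) that by (auto simp: best_pair_def)
  have nonneg: "0 \<le> best"
    using assms(1) by (auto simp: best_pair_def)
  show "best_pair v (insert (i, g) S) g (v i g)" if "best < v i g"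
    using le nonneg that \<open>g \<noteq> 0\<close> order_trans[OF le less_imp_le[OF that]]
    by (auto simp: best_pair_def)
  show "best_pair v (insert (i, g) S) cur best" if "\<not> best < v i g"
    using assms(1) that by (auto simp: best_pair_def)
qed

text \<open>If no positive value was seen, no good is unserved, since each good is valued by
  someone. Otherwise the largest single value among the unserved goods singles out one with the
  largest top value.\<close>

lemma next_good_best_pair:
  assumes inst: "fair_division_instance n m v"
    and best: "best_pair v ({1..n} \<times> unassigned m own) cur b"
  shows "next_good n m v own cur"
proof -
  have n: "n \<ge> 1" using inst by (simp add: fair_division_instance_def)
  show ?thesis
  proof (cases "cur = 0")
    case True
    then have le: "v i g \<le> 0" if "i \<in> {1..n}" "g \<in> unassigned m own" for i g
      using best that by (auto simp: best_pair_def)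
    have False if g: "g \<in> unassigned m own" for g
    proof -
      have "g \<in> {1..m}" using g by (simp add: unassigned_def)
      then obtain i where "i \<in> {1..n}" "v i g > 0"
        using inst unfolding fair_division_instance_def by blast
      with le[of i g] g show False by simp
    qed
    then have "unassigned m own = {}" by blast
    then show ?thesis using True by (simp add: next_good_def)
  next
    case False
    then obtain i where i: "i \<in> {1..n}" "cur \<in> unassigned m own" "b = v i cur"
      using best by (auto simp: best_pair_def)
    have "top_value n v g \<le> top_value n v cur" if g: "g \<in> unassigned m own" for g
    proof -
      obtain j where "j \<in> {1..n}" "v j g = top_value n v g"
        using top_value_attained[OF n] by blast
      then have "top_value n v g \<le> b"
        using best g by (force simp: best_pair_def)
      also have "b \<le> top_value n v cur"
        using i top_value_ge by simp
      finally show ?thesis .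
    qed
    then show ?thesis using False i by (simp add: next_good_def)
  qed
qed

lemma runs_pick_good:
  assumes s: "dims n m v s" "n \<le> K" "m \<le> K" and inst: "fair_division_instance n m v"
  shows "runs K pick_good s (\<lambda>s'. next_good n m v (nmem s ''owner'') (nmem s' ''cur'' 0))"
proof -
  let ?own = "nmem s ''owner''"
  let ?B = "\<lambda>S s'. best_pair v S (nmem s' ''cur'' 0) (rmem s' ''best'' 0)"
  let ?S = "\<lambda>k. {1..n} \<times> unassigned k ?own"
  let ?upd = "If1 (RLess (RVar ''best'') (RVal (NVar ''i'') (NVar ''g'')))
    (Seq (RSet ''best'' (RVal (NVar ''i'') (NVar ''g''))) (NSet ''cur'' (NVar ''g'')))"
  let ?body = "If1 (NLess (NGet ''owner'' (NVar ''g'')) (NConst 1)) (For ''i'' ''n'' ?upd)"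
  have S_Suc: "?S (Suc k) = (if ?own (Suc k) = 0 then ?S k \<union> {1..n} \<times> {Suc k} else ?S k)" for k
    by (auto simp: unassigned_def le_Suc_eq)
  show ?thesis
    unfolding pick_good_def
  proof (rule runs_Seq, rule runs_NAssign, rule runs_Seq, rule runs_RAssign,
      rule runs_For[where N = m and I = "\<lambda>k. ?B (?S k)"])
    let ?s' = "nupdate ''cur'' (neval (NConst 0) s) (neval (NConst 0) s) s"
    let ?s = "rupdate ''best'' (neval (NConst 0) ?s') (reval (RConst 0) ?s') ?s'"
    show "?B (?S 0) ?s" by (simp add: best_pair_def unassigned_def)
    fix k r
    assume fr: "frame (insert ''g'' (writes ?body)) ?s r" and g: "nmem r ''g'' 0 = Suc k"
      and I: "?B (?S k) r"
    have r: "nmem r ''n'' 0 = n" "nmem r ''owner'' = ?own" "matrix r = v"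
      using fr s(1) by (simp_all add: frame_nmem frame_matrix dims_def)
    show "runs K ?body r (?B (?S (Suc k)))"
    proof (rule runs_If1)
      assume "beval (NLess (NGet ''owner'' (NVar ''g'')) (NConst 1)) r"
      then have zero: "?own (Suc k) = 0" by (simp add: g r)
      show "runs K (For ''i'' ''n'' ?upd) r (?B (?S (Suc k)))"
      proof (rule runs_For[where N = n and I = "\<lambda>l. ?B (?S k \<union> {1..l} \<times> {Suc k})"])
        show "?B (?S k \<union> {1..0} \<times> {Suc k}) r" using I by simp
        show "?B (?S (Suc k)) q" if "?B (?S k \<union> {1..n} \<times> {Suc k}) q" for q
          using that unfolding S_Suc by (simp add: zero)
        fix l q
        assume fq: "frame (insert ''i'' (writes ?upd)) r q" and i: "nmem q ''i'' 0 = Suc l"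
          and J: "?B (?S k \<union> {1..l} \<times> {Suc k}) q"
        have q: "matrix q = v" "nmem q ''g'' 0 = Suc k"
          using fq by (simp_all add: frame_nmem frame_matrix r g)
        have eq: "?S k \<union> {1..Suc l} \<times> {Suc k} = insert (Suc l, Suc k) (?S k \<union> {1..l} \<times> {Suc k})"
          by (auto simp: le_Suc_eq)
        note ins = best_pair_insert[OF J, of "Suc k" "Suc l"]
        show "runs K ?upd q (?B (?S k \<union> {1..Suc l} \<times> {Suc k}))"
          unfolding eq
          by (intro runs_If1 runs_Seq runs_NAssign runs_RAssign) (use ins in \<open>simp_all add: q i\<close>)
      qed (use s(2) r in simp_all)
    next
      assume "\<not> beval (NLess (NGet ''owner'' (NVar ''g'')) (NConst 1)) r"
      then have "?own (Suc k) \<noteq> 0" by (simp add: g r)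
      then show "?B (?S (Suc k)) r" using I unfolding S_Suc by simp
    qed
  next
    fix r assume "?B (?S m) r"
    then show "next_good n m v ?own (nmem r ''cur'' 0)"
      by (rule next_good_best_pair[OF inst])
  qed (use s in \<open>simp_all add: dims_def\<close>)
qed

lemma runs_program:
  assumes s: "dims n m v s" and owner: "\<forall>g. nmem s ''owner'' g = 0"
    and inst: "fair_division_instance n m v"
  shows "runs ((n + m + 1) * ((n + m) * (n + m) + 1)) program s (\<lambda>s'.
    partial_allocation n m v (nmem s' ''owner'') \<and> unassigned m (nmem s' ''owner'') = {})"
proof -
  \<comment> \<open>One number must dominate all loops: \<open>n\<close> and \<open>m\<close> for
    the counting loops, \<open>n\<close> for a rotation and \<open>m * (n * n + 1) + n * n\<close>
    for the main loop, enlarged here to a polynomial in \<open>n + m\<close>.\<close>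
  define K where "K = (n + m + 1) * ((n + m) * (n + m) + 1)"
  have nK: "n \<le> K" and mK: "m \<le> K" by (simp_all add: K_def)
  have work_le: "work n m v own \<le> K" for own
  proof -
    have "card (unassigned m own) \<le> card {1..m}"
      by (rule card_mono) (auto simp: unassigned_def)
    then have "work n m v own \<le> m * (n * n + 1) + n * n"
      unfolding work_def using envy_count_le by (intro add_mono mult_right_mono) auto
    also have "\<dots> \<le> K" by (simp add: K_def algebra_simps)
    finally show ?thesis .
  qed
  have empty: "share m (nmem s ''owner'') j = {}" if "j \<in> {1..n}" for j
    using owner that by (auto simp: share_def)
  \<comment> \<open>Before any service all bundles are empty, so the fairness condition is
    vacuous.\<close>
  have part0: "partial_allocation n m v (nmem s ''owner'')"
    using owner empty by (auto simp: partial_allocation_def fair_except_last_def bundles_def)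
  define J where "J s' \<longleftrightarrow> dims n m v s' \<and> partial_allocation n m v (nmem s' ''owner'') \<and>
    next_good n m v (nmem s' ''owner'') (nmem s' ''cur'' 0)" for s' :: state
  show ?thesis
    unfolding K_def[symmetric] program_def
  proof (rule runs_Seq, rule runs_conseq[OF runs_pick_good[OF s nK mK inst]],
      rule runs_While[where I = J and \<mu> = "\<lambda>s'. work n m v (nmem s' ''owner'')"])
    fix r
    assume "frame (writes pick_good) s r" "next_good n m v (nmem s ''owner'') (nmem r ''cur'' 0)"
    then show "J r"
      using s part0 by (simp add: J_def dims_frame frame_nmem)
    show "work n m v (nmem r ''owner'') \<le> K" by (rule work_le)
  next
    fix r assume J: "J r" and "beval (NLess (NConst 0) (NVar ''cur'')) r"
    then have r: "dims n m v r" "partial_allocation n m v (nmem r ''owner'')"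
      "next_good n m v (nmem r ''owner'') (nmem r ''cur'' 0)" "nmem r ''cur'' 0 \<noteq> 0"
      by (simp_all add: J_def)
    let ?dec = "\<lambda>s'. J s' \<and> work n m v (nmem s' ''owner'') < work n m v (nmem r ''owner'')"
    show "runs K (Seq serve_good pick_good) r ?dec"
    proof (rule runs_Seq, rule runs_conseq[OF runs_serve_good[OF r(1) nK mK inst r(2-4)]])
      fix q assume fr: "frame (writes serve_good) r q"
        and q: "partial_allocation n m v (nmem q ''owner'') \<and>
          work n m v (nmem q ''owner'') < work n m v (nmem r ''owner'')"
      have dims: "dims n m v q" using fr r(1) by (simp add: dims_frame)
      show "runs K pick_good q ?dec"
      proof (rule runs_conseq[OF runs_pick_good[OF dims nK mK inst]])
        fix p assume "frame (writes pick_good) q p"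
          "next_good n m v (nmem q ''owner'') (nmem p ''cur'' 0)"
        then show "?dec p" using q dims by (simp add: J_def dims_frame frame_nmem)
      qed
    qed
  next
    fix r assume "J r" "\<not> beval (NLess (NConst 0) (NVar ''cur'')) r"
    then show "partial_allocation n m v (nmem r ''owner'') \<and> unassigned m (nmem r ''owner'') = {}"
      by (simp add: J_def next_good_def)
  qed
qed

section \<open>Transfer to the stored matrix and conclusion\<close>

lemma val_cong: "(\<And>g. g \<in> S \<Longrightarrow> v i g = w i g) \<Longrightarrow> val v i S = val w i S"
  by (simp add: val_def)

text \<open>All notions look at values of agents and goods in range only; for fairness this rests on
  shares lying inside \<open>{1..m}\<close>.\<close>

lemma instance_cong:
  assumes "\<And>i g. i \<in> {1..n} \<Longrightarrow> g \<in> {1..m} \<Longrightarrow> v i g = w i g"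
  shows "fair_division_instance n m v \<longleftrightarrow> fair_division_instance n m w"
    and "range_param n m v = range_param n m w"
    and "is_tEFx \<beta> n m v (share m own) \<longleftrightarrow> is_tEFx \<beta> n m w (share m own)"
proof -
  have pos: "pos_goods m v i = pos_goods m w i" if "i \<in> {1..n}" for i
    using assms that by (auto simp: pos_goods_def)
  show "fair_division_instance n m v \<longleftrightarrow> fair_division_instance n m w"
    using assms pos by (auto simp: fair_division_instance_def)
  have "good_range n v g = good_range n w g" if "g \<in> {1..m}" for g
  proof -
    have "(\<lambda>j. v j g) ` {j \<in> {1..n}. v j g > 0} = (\<lambda>j. w j g) ` {j \<in> {1..n}. w j g > 0}"
      "(\<lambda>i. v i g) ` {1..n} = (\<lambda>i. w i g) ` {1..n}"
      using assms that by (auto simp: image_iff)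
    then show ?thesis by (simp only: good_range_def)
  qed
  then have "good_range n v ` {1..m} = good_range n w ` {1..m}"
    by (intro image_cong) simp_all
  then show "range_param n m v = range_param n m w"
    by (simp only: range_param_def)
  have "tEFx_ineq \<alpha> n m v (share m own) \<longleftrightarrow> tEFx_ineq \<alpha> n m w (share m own)" for \<alpha>
    unfolding tEFx_ineq_def
  proof (intro ball_cong refl)
    fix i j g assume i: "i \<in> {1..n}"
    then show "share m own j \<inter> pos_goods m v i = share m own j \<inter> pos_goods m w i"
      by (simp add: pos)
    assume "g \<in> share m own j \<inter> pos_goods m w i"
    then have "share m own i \<union> {g} \<subseteq> {1..m}" "share m own j - {g} \<subseteq> {1..m}"
      by (auto simp: share_def)
    then have "val v i (share m own i \<union> {g}) = val w i (share m own i \<union> {g})"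
      "val v i (share m own j - {g}) = val w i (share m own j - {g})"
      using assms[OF i] by (blast intro: val_cong)+
    then show "(val v i (share m own i \<union> {g}) \<ge> \<alpha> * val v i (share m own j - {g})) =
        (val w i (share m own i \<union> {g}) \<ge> \<alpha> * val w i (share m own j - {g}))"
      by simp
  qed
  then show "is_tEFx \<beta> n m v (share m own) \<longleftrightarrow> is_tEFx \<beta> n m w (share m own)"
    by (simp add: is_tEFx_def)
qed

theorem theorem2:
  "\<exists>(prog :: com) (p :: nat poly). \<forall>(n :: nat) (m :: nat) (v :: nat \<Rightarrow> nat \<Rightarrow> real).
     fair_division_instance n m v \<longrightarrow>
     (\<exists>t s. exec prog (initial_state n m v) t s \<and> t \<le> poly p (n + m) \<and>
        is_tEFx (2 * range_param n m v) n m v (output_allocation m s))"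
proof (rule exI[of _ program], rule exI[of _ "time_poly program \<circ>\<^sub>p ([:1, 1:] * [:1, 0, 1:])"],
    intro allI impI)
  fix n m :: nat and v :: "nat \<Rightarrow> nat \<Rightarrow> real" assume inst: "fair_division_instance n m v"
  let ?s = "initial_state n m v" and ?K = "(n + m + 1) * ((n + m) * (n + m) + 1)"
  \<comment> \<open>The polynomial (1 + x)(1 + x^2), whose value at \<open>n + m\<close> is
    \<open>?K\<close>; composing with it turns the bound in \<open>?K\<close> into one in
    \<open>n + m\<close>.\<close>
  let ?loops = "[:1, 1:] * [:1, 0, 1:] :: nat poly"
  \<comment> \<open>The stored matrix is \<open>v\<close> cut off to 0 outside the range, so the
    program is analysed for \<open>w\<close> and the result carried back to
    \<open>v\<close>.\<close>
  define w where "w = matrix ?s"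
  have w: "w i g = v i g" if "i \<in> {1..n}" "g \<in> {1..m}" for i g
    using that by (simp add: w_def initial_state_def)
  have inst_w: "fair_division_instance n m w"
    using inst instance_cong(1)[OF w] by simp
  have "dims n m w ?s" "\<forall>g. nmem ?s ''owner'' g = 0"
    by (simp_all add: dims_def w_def initial_state_def)
  from runs_program[OF this inst_w] obtain t s where
    t: "exec program ?s t s" "t \<le> poly (time_poly program) ?K"
    and s: "partial_allocation n m w (nmem s ''owner'')" "unassigned m (nmem s ''owner'') = {}"
    unfolding runs_def by blast
  have "is_tEFx (2 * range_param n m v) n m v (share m (nmem s ''owner''))"
    using partial_allocation_is_tEFx[OF inst_w s] instance_cong(2,3)[OF w] by simp
  moreover have "share m (nmem s ''owner'') = output_allocation m s"
    by (intro ext) (simp add: share_def output_allocation_def)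
  moreover have "poly ?loops (n + m) = ?K" by (simp add: algebra_simps)
  then have "t \<le> poly (time_poly program \<circ>\<^sub>p ?loops) (n + m)"
    using t(2) by (simp only: poly_pcompose)
  ultimately show "\<exists>t s. exec program ?s t s \<and> t \<le> poly (time_poly program \<circ>\<^sub>p ?loops) (n + m) \<and>
      is_tEFx (2 * range_param n m v) n m v (output_allocation m s)"
    using t(1) by auto
qed

end
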